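(* Let $a>0$ and let $q:\mathbb{R}\to\mathbb{R}$ be a real potential with $\int_{\mathbb{R}}|q(x)|^2e^{2a|x|}\,dx<\infty$. For $0<|\lambda|<a/3$ let $T(\lambda)=[t_{k,l}(\lambda)]_{k,l=0}^2$ be the transition matrix, defined by $u_k(\lambda,x)=\sum_{l=0}^2t_{k,l}(\lambda)v_l(\lambda,x)$ ($0\le k\le2$), where $\{u_k\}$ and $\{v_k\}$ are the Jost solutions at $-\infty$ and $+\infty$ respectively. Then $T(\lambda)$ is unimodular, $\det T(\lambda)=1$, and $$J=T(\lambda)\,J\,T^+(\overline\lambda)\qquad\text{for all }\lambda\text{ with }0<|\lambda|<a/3,$$ where $$J=\begin{bmatrix}\zeta_0&0&0\\0&0&\zeta_2\\0&\zeta_1&0\end{bmatrix}.$$ Moreover, for all such $\lambda$, $$1=t_{0,0}(\lambda)t_{0,0}^*(\lambda)+\zeta_1t_{0,2}(\lambda)t_{0,1}^*(\lambda)+\zeta_2t_{0,1}(\lambda)t_{0,2}^*(\lambda).$$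
   Context: $f^*(\lambda)=\overline{f(\overline\lambda)}$; $T^+(\overline\lambda)$ is the conjugate transpose of the matrix $T(\overline\lambda)$. $\zeta_0=1$, $\zeta_1=\frac12(-1+i\sqrt3)$, $\zeta_2=\frac12(-1-i\sqrt3)$ are the cube roots of unity, and $s_2(z)=\frac13\sum_{k=0}^2\zeta_k^{-2}e^{\zeta_kz}$. Put $K_1(\lambda,x,t)=\dfrac{s_2(i\lambda(x-t))}{(i\lambda)^2}$ (with value $\frac{(x-t)^2}2$ at $\lambda=0$). For $|\lambda|<a/3$ the Jost solutions $v_k(\lambda,x)$, $0\le k\le 2$, are the solutions of $iy'''+qy=\lambda^3y$ with $v_k(\lambda,x)-e^{i\lambda\zeta_kx}\to0$ as $x\to+\infty$ given by $v_k(\lambda,x)=e^{i\lambda\zeta_kx}+\int_x^\infty N(\lambda,x,t)q(t)e^{i\lambda\zeta_kt}dt$, where $N=\sum_{n\ge1}(-i)^nK_n$ and $K_{n+1}(\lambda,x,t)=\int_x^tK_n(\lambda,x,s)q(s)K_1(\lambda,s,t)ds$ for $t\ge x$; they satisfy $v_k(\lambda,x)=e^{i\lambda\zeta_kx}-i\int_x^\infty K_1(\lambda,x,t)q(t)v_k(\lambda,t)dt$. Similarly, the Jost solutions $u_k(\lambda,x)$ are the solutions of the same equation with $u_k(\lambda,x)-e^{i\lambda\zeta_kx}\to0$ as $x\to-\infty$ given by $u_k(\lambda,x)=e^{i\lambda\zeta_kx}+\int_{-\infty}^x\widehat N(\lambda,x,t)q(t)e^{i\lambda\zeta_kt}dt$,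 where $\widehat N=\sum_{n\ge1}i^n\widehat K_n$, $\widehat K_1=K_1$ and $\widehat K_{n+1}(\lambda,x,t)=\int_t^x\widehat K_n(\lambda,x,s)q(s)K_1(\lambda,s,t)ds$ for $t\le x$; they satisfy $u_k(\lambda,x)=e^{i\lambda\zeta_kx}+i\int_{-\infty}^xK_1(\lambda,x,t)q(t)u_k(\lambda,t)dt$. For $0<|\lambda|<a/3$ the $v_k$ are linearly independent solutions, so the $t_{k,l}(\lambda)$ are well defined. *)

theory Defs
  imports "HOL-Analysis.Analysis"
begin

text \<open>
  The index set $\{0,1,2\}$ is the library type \<^typ>\<open>3\<close>, whose elements are \<open>0\<close>, \<open>1\<close>, \<open>2\<close>
  (and \<open>3 = 0\<close>).  The library's \<^const>\<open>vector\<close> notation is avoided for matrices, since it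
  places its first entry at index \<open>1\<close> and its third at \<open>3 = 0\<close>.
\<close>

definition zeta :: "3 \<Rightarrow> complex" where
  "zeta k = (if k = 0 then 1
             else if k = 1 then (1/2) * (-1 + \<i> * sqrt 3)
             else (1/2) * (-1 - \<i> * sqrt 3))"

definition s2 :: "complex \<Rightarrow> complex" where
  "s2 z = (1/3) * (\<Sum>k\<in>UNIV. zeta k powi (-2) * exp (zeta k * z))"

definition K1 :: "complex \<Rightarrow> real \<Rightarrow> real \<Rightarrow> complex" where
  "K1 lam x t = (if lam = 0 then of_real ((x - t)^2 / 2)
               else s2 (\<i> * lam * of_real (x - t)) / (\<i> * lam)^2)"

text \<open>
  The potential \<open>q\<close> is only Lebesgue measurable, so all integrals are taken with respect to
  \<^const>\<open>lebesgue\<close>.  The iterated kernels are counted from zero: \<open>Kplus q lam n\<close> is $K_{n+1}$ and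
  \<open>Kminus q lam n\<close> is $\widehat K_{n+1}$.  They are meaningful for $t \ge x$ and for $t \le x$
  respectively; outside these ranges the integrals are over empty intervals, and the values are
  not used.
\<close>

primrec Kplus :: "(real \<Rightarrow> real) \<Rightarrow> complex \<Rightarrow> nat \<Rightarrow> real \<Rightarrow> real \<Rightarrow> complex" where
  "Kplus q lam 0 = K1 lam"
| "Kplus q lam (Suc n) =
     (\<lambda>x t. LINT s:{x..t}|lebesgue. Kplus q lam n x s * of_real (q s) * K1 lam s t)"

primrec Kminus :: "(real \<Rightarrow> real) \<Rightarrow> complex \<Rightarrow> nat \<Rightarrow> real \<Rightarrow> real \<Rightarrow> complex" where
  "Kminus q lam 0 = K1 lam"
| "Kminus q lam (Suc n) =
     (\<lambda>x t. LINT s:{t..x}|lebesgue. Kminus q lam n x s * of_real (q s) * K1 lam s t)"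

definition Nplus :: "(real \<Rightarrow> real) \<Rightarrow> complex \<Rightarrow> real \<Rightarrow> real \<Rightarrow> complex" where
  "Nplus q lam x t = (\<Sum>n. (-\<i>)^(Suc n) * Kplus q lam n x t)"

definition Nminus :: "(real \<Rightarrow> real) \<Rightarrow> complex \<Rightarrow> real \<Rightarrow> real \<Rightarrow> complex" where
  "Nminus q lam x t = (\<Sum>n. \<i>^(Suc n) * Kminus q lam n x t)"

definition jost_v :: "(real \<Rightarrow> real) \<Rightarrow> 3 \<Rightarrow> complex \<Rightarrow> real \<Rightarrow> complex" where
  "jost_v q k lam x = exp (\<i> * lam * zeta k * of_real x)
     + (LINT t:{x..}|lebesgue. Nplus q lam x t * of_real (q t) * exp (\<i> * lam * zeta k * of_real t))"

definition jost_u :: "(real \<Rightarrow> real) \<Rightarrow> 3 \<Rightarrow> complex \<Rightarrow> real \<Rightarrow> complex" where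
  "jost_u q k lam x = exp (\<i> * lam * zeta k * of_real x)
     + (LINT t:{..x}|lebesgue. Nminus q lam x t * of_real (q t) * exp (\<i> * lam * zeta k * of_real t))"

text \<open>
  The defining relation determines the matrix uniquely whenever the \<open>jost_v q l lam\<close> are linearly
  independent solutions, in particular for $0 < |\lambda| < a/3$ with \<open>q\<close> in the weighted space.
\<close>

definition transition_matrix :: "(real \<Rightarrow> real) \<Rightarrow> complex \<Rightarrow> complex^3^3" where
  "transition_matrix q lam =
     (THE T. \<forall>k x. jost_u q k lam x = (\<Sum>l\<in>UNIV. T $ k $ l * jost_v q l lam x))"

definition transition_coeff :: "(real \<Rightarrow> real) \<Rightarrow> 3 \<Rightarrow> 3 \<Rightarrow> complex \<Rightarrow> complex" where
  "transition_coeff q k l lam = transition_matrix q lam $ k $ l"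

definition cnj_fun :: "(complex \<Rightarrow> complex) \<Rightarrow> complex \<Rightarrow> complex" where
  "cnj_fun f lam = cnj (f (cnj lam))"

definition conj_transpose :: "complex^'n^'m \<Rightarrow> complex^'m^'n" where
  "conj_transpose A = (\<chi> k l. cnj (A $ l $ k))"

definition J_mat :: "complex^3^3" where
  "J_mat = (\<chi> k l. if k = 0 \<and> l = 0 then zeta 0
                   else if k = 1 \<and> l = 2 then zeta 2
                   else if k = 2 \<and> l = 1 then zeta 1
                   else 0)"

end

theory Submission
  imports Defs
begin

text \<open>
  By variation of constants every Jost solution is a combination of the plane waves
  $e^{i\lambda\zeta_l x}$ whose amplitudes are primitives of integrable functions:
  $c_l' = \frac{i\zeta_l}{3(i\lambda)^2} e^{-i\lambda\zeta_l x} q y$.  Hence the row vectors of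
  amplitudes solve a first order system $c' = cB$ with $B$ of rank one and trace $0$, for which
  $JB(\overline\lambda)^+ + B(\lambda)J = 0$.  So the determinant and the form $cJd^+$ are constant in $x$,
  and their values are read off at the end where the amplitude matrix is the identity.
  The transition matrix is the quotient of the two amplitude matrices.

  Only a product rule for primitives of integrable functions is needed, no differentiability.  The
  solutions at $+\infty$ are those at $-\infty$ for the potential $-q(-x)$ and the parameter $-\lambda$.
\<close>

subsection \<open>Primitives of integrable functions\<close>

text \<open>Since \<open>transition_matrix\<close> is a definite description, existence and
  uniqueness of the expansion have to be proved before its determinant or form means anything. No
  uniqueness theorem for the differential equation is used. Conservation of the form together with
  J^2 = 1 exhibits an inverse of each amplitude matrix, built from the amplitude matrix at the
  conjugate parameter. The quotient of two amplitude matrices thereby becomes a mixed form, which is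
  conserved for the same reason, so it does not depend on x. The analytic work lies in reaching the
  amplitudes. The Jost solutions are given by a resolvent series whose kernels grow by a factor on
  the right, whereas the amplitudes come from the integral equation, where K1 stands on the left;
  Fubini reconciles the two. All exchanges of sum and integral rest on one weight, exp(2 |lam| |t|),
  which is within reach because |lam| < a/3 gives 2 |lam| < a. Joint measurability of the integrands
  is obtained for Borel \<open>q\<close>; a Lebesgue measurable potential is replaced by a Borel
  representative at the very end.\<close>

text \<open>The constant \<open>c\<close> is the limit of \<open>F\<close> at minus infinity. It is
  carried along because the invariants are evaluated there: a vanishing density leaves
  \<open>F x = c\<close>.\<close>

definition primitive_from ::
  "'a::{real_normed_field, banach, second_countable_topology} \<Rightarrow> (real \<Rightarrow> 'a) \<Rightarrow> (real \<Rightarrow> 'a) \<Rightarrow> bool"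
  where "primitive_from c F f \<longleftrightarrow>
    integrable lborel f \<and> (\<forall>x. F x = c + (LINT t:{..x}|lborel. f t))"

lemma integrable_pair_mult:
  fixes f g :: "real \<Rightarrow> 'a::{real_normed_field, banach, second_countable_topology}"
  assumes f: "integrable lborel f" and g: "integrable lborel g"
  shows "integrable (lborel \<Otimes>\<^sub>M lborel) (\<lambda>(x, y). f x * g y)"
proof (rule lborel_pair.Fubini_integrable)
  have [measurable]: "f \<in> borel_measurable borel" "g \<in> borel_measurable borel"
    using f g by (auto dest: borel_measurable_integrable)
  show "(\<lambda>(x, y). f x * g y) \<in> borel_measurable (lborel \<Otimes>\<^sub>M lborel)"
    by measurable
  show "integrable lborel (\<lambda>x. \<integral>y. norm (case (x, y) of (x, y) \<Rightarrow> f x * g y) \<partial>lborel)"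
    using f by (simp add: norm_mult)
  show "AE x in lborel. integrable lborel (\<lambda>y. case (x, y) of (x, y) \<Rightarrow> f x * g y)"
    using g by simp
qed

lemma primitive_from_measurable [measurable_dest]:
  assumes "primitive_from c F f"
  shows "F \<in> borel_measurable borel"
proof -
  have [measurable]: "f \<in> borel_measurable borel"
    using assms by (auto simp: primitive_from_def dest: borel_measurable_integrable)
  have "F = (\<lambda>x. c + (\<integral>t. (if t \<le> x then f t else 0) \<partial>lborel))"
    using assms unfolding primitive_from_def set_lebesgue_integral_def
    by (intro ext) (auto intro!: Bochner_Integration.integral_cong)
  also have "\<dots> \<in> borel_measurable borel"
    by measurable
  finally show ?thesis .
qed

lemma primitive_from_bound:
  assumes "primitive_from c F f"
  shows "norm (F x) \<le> norm c + (\<integral>t. norm (f t) \<partial>lborel)"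
proof -
  have f: "integrable lborel f"
    using assms by (simp add: primitive_from_def)
  have "norm (LINT t:{..x}|lborel. f t) \<le> (\<integral>t. norm (indicator {..x} t *\<^sub>R f t) \<partial>lborel)"
    unfolding set_lebesgue_integral_def by (rule integral_norm_bound)
  also have "\<dots> \<le> (\<integral>t. norm (f t) \<partial>lborel)"
    using f by (intro integral_mono integrable_norm integrable_mult_indicator)
      (auto simp: indicator_def)
  finally show ?thesis
    using assms norm_triangle_ineq[of c "LINT t:{..x}|lborel. f t"]
    by (simp add: primitive_from_def)
qed

lemma integrable_mult_primitive:
  assumes "integrable lborel f" "primitive_from d G g"
  shows "integrable lborel (\<lambda>x. f x * G x)"
proof (rule Bochner_Integration.integrable_bound)
  have [measurable]: "f \<in> borel_measurable borel" "G \<in> borel_measurable borel"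
    using assms by (auto dest: borel_measurable_integrable primitive_from_measurable)
  show "(\<lambda>x. f x * G x) \<in> borel_measurable lborel"
    by measurable
  show "integrable lborel (\<lambda>x. (norm d + (\<integral>t. norm (g t) \<partial>lborel)) * norm (f x))"
    using assms by (intro integrable_mult_right integrable_norm)
  show "AE x in lborel. norm (f x * G x)
      \<le> norm ((norm d + (\<integral>t. norm (g t) \<partial>lborel)) * norm (f x))"
  proof (rule AE_I2)
    fix x
    have "norm (f x * G x) \<le> (norm d + (\<integral>t. norm (g t) \<partial>lborel)) * norm (f x)"
      using mult_right_mono[OF primitive_from_bound[OF assms(2), of x] norm_ge_zero[of "f x"]]
      by (simp add: norm_mult mult.commute)
    then show "norm (f x * G x) \<le> norm ((norm d + (\<integral>t. norm (g t) \<partial>lborel)) * norm (f x))"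
      by simp
  qed
qed

lemma primitive_from_const: "primitive_from c (\<lambda>x. c) (\<lambda>x. 0)"
  by (simp add: primitive_from_def set_lebesgue_integral_def)

lemma primitive_from_add:
  assumes "primitive_from c F f" "primitive_from d G g"
  shows "primitive_from (c + d) (\<lambda>x. F x + G x) (\<lambda>x. f x + g x)"
proof -
  have "set_integrable lborel {..x} f" "set_integrable lborel {..x} g" for x
    using assms unfolding set_integrable_def primitive_from_def
    by (auto intro!: integrable_mult_indicator)
  then show ?thesis
    using assms by (auto simp: primitive_from_def set_integral_add)
qed

lemma primitive_from_cmult:
  assumes "primitive_from c F f"
  shows "primitive_from (a * c) (\<lambda>x. a * F x) (\<lambda>x. a * f x)"
  using assms by (auto simp: primitive_from_def distrib_left)

lemma primitive_from_sum:
  assumes "\<And>i. i \<in> I \<Longrightarrow> primitive_from (c i) (F i) (f i)"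
  shows "primitive_from (\<Sum>i\<in>I. c i) (\<lambda>x. \<Sum>i\<in>I. F i x) (\<lambda>x. \<Sum>i\<in>I. f i x)"
  using assms
  by (induction I rule: infinite_finite_induct)
    (auto intro: primitive_from_const primitive_from_add)

lemma primitive_from_cnj:
  assumes "primitive_from c F f"
  shows "primitive_from (cnj c) (\<lambda>x. cnj (F x)) (\<lambda>x. cnj (f x))"
proof -
  have "(LINT t:{..x}|lborel. cnj (f t)) = cnj (LINT t:{..x}|lborel. f t)" for x
    by (simp add: set_lebesgue_integral_def flip: complex_cnj_scaleR)
  then show ?thesis
    using assms by (simp add: primitive_from_def)
qed

text \<open>Integration by parts, obtained from Fubini on the triangle s \<le> t \<le> x:
  integrating f(s) g(t) over s first produces F g, over t first it produces f(s) (G(x) -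
  G(s)).\<close>

lemma primitive_from_mult_zero:
  assumes F: "primitive_from 0 F f" and G: "primitive_from 0 G g"
  shows "primitive_from 0 (\<lambda>x. F x * G x) (\<lambda>x. f x * G x + F x * g x)"
proof -
  have f: "integrable lborel f" and g: "integrable lborel g"
    using F G by (auto simp: primitive_from_def)
  then have [measurable]: "f \<in> borel_measurable borel" "g \<in> borel_measurable borel"
    by (auto dest: borel_measurable_integrable)
  have fG: "integrable lborel (\<lambda>x. f x * G x)"
    by (rule integrable_mult_primitive[OF f G])
  have Fg: "integrable lborel (\<lambda>x. F x * g x)"
    using integrable_mult_primitive[OF g F] by (simp add: mult.commute)
  have "F x * G x = (LINT t:{..x}|lborel. f t * G t + F t * g t)" for x
  proof -
    define h where "h = (\<lambda>s t. if s \<le> t \<and> t \<le> x then f s * g t else 0)"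
    have h: "integrable (lborel \<Otimes>\<^sub>M lborel) (case_prod h)"
      by (rule Bochner_Integration.integrable_bound[OF integrable_pair_mult[OF f g]])
        (auto simp: h_def split_beta' intro!: AE_I2)
    have "(LINT t:{..x}|lborel. F t * g t) = (\<integral>t. (\<integral>s. h s t \<partial>lborel) \<partial>lborel)"
      unfolding set_lebesgue_integral_def
    proof (rule Bochner_Integration.integral_cong[OF refl])
      fix t
      have "F t = (\<integral>s. indicator {..t} s *\<^sub>R f s \<partial>lborel)"
        using F by (simp add: primitive_from_def set_lebesgue_integral_def)
      then show "indicator {..x} t *\<^sub>R (F t * g t) = (\<integral>s. h s t \<partial>lborel)"
        by (cases "t \<le> x")
          (auto simp: h_def indicator_def simp flip: integral_mult_left_zero
            intro!: Bochner_Integration.integral_cong)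
    qed
    also have "\<dots> = (\<integral>s. (\<integral>t. h s t \<partial>lborel) \<partial>lborel)"
      by (rule lborel_pair.Fubini_integral[OF h])
    also have "\<dots> = (LINT s:{..x}|lborel. f s * (G x - G s))"
      unfolding set_lebesgue_integral_def
    proof (rule Bochner_Integration.integral_cong[OF refl])
      fix s
      show "(\<integral>t. h s t \<partial>lborel) = indicator {..x} s *\<^sub>R (f s * (G x - G s))"
      proof (cases "s \<le> x")
        case True
        have gi: "integrable lborel (\<lambda>t. indicator {..y} t *\<^sub>R g t)" for y
          using g by (intro integrable_mult_indicator) auto
        have "(\<integral>t. h s t \<partial>lborel)
            = (\<integral>t. f s * (indicator {..x} t *\<^sub>R g t - indicator {..s} t *\<^sub>R g t) \<partial>lborel)"
        proof (rule integral_cong_AE)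
          \<comment> \<open>The two sides differ only on the diagonal t = s, which \<open>h\<close>
            includes and the difference of indicators removes.\<close>
          show "AE t in lborel. h s t
              = f s * (indicator {..x} t *\<^sub>R g t - indicator {..s} t *\<^sub>R g t)"
            using AE_lborel_singleton[of s]
            by eventually_elim (use True in \<open>auto simp: h_def indicator_def\<close>)
        qed (simp_all add: h_def)
        also have "\<dots> = f s * (G x - G s)"
          using gi G by (simp add: primitive_from_def set_lebesgue_integral_def)
        finally show ?thesis
          using True by simp
      next
        case False
        then have "h s = (\<lambda>t. 0)"
          by (auto simp: h_def fun_eq_iff)
        with False show ?thesis
          by simp
      qed
    qed
    also have "\<dots> = (LINT s:{..x}|lborel. f s * G x) - (LINT s:{..x}|lborel. f s * G s)"
      using f fG
      by (simp add: right_diff_distrib set_integrable_def integrable_mult_indicator set_integral_diff)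
    also have "(LINT s:{..x}|lborel. f s * G x) = F x * G x"
      using F by (simp add: primitive_from_def)
    finally show ?thesis
      using fG Fg by (simp add: set_integral_add set_integrable_def integrable_mult_indicator)
  qed
  then show ?thesis
    using fG Fg by (simp add: primitive_from_def)
qed

text \<open>Subtracting the limits reduces to the zero case; FG is recovered as (F - c)(G - d) + cd
  + c(G - d) + d(F - c).\<close>

lemma primitive_from_mult:
  assumes F: "primitive_from c F f" and G: "primitive_from d G g"
  shows "primitive_from (c * d) (\<lambda>x. F x * G x) (\<lambda>x. f x * G x + F x * g x)"
proof -
  have F0: "primitive_from 0 (\<lambda>x. F x - c) f" and G0: "primitive_from 0 (\<lambda>x. G x - d) g"
    using F G by (auto simp: primitive_from_def)
  have "primitive_from (0 + c * d + c * 0 + d * 0)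
      (\<lambda>x. (F x - c) * (G x - d) + c * d + c * (G x - d) + d * (F x - c))
      (\<lambda>x. (f x * (G x - d) + (F x - c) * g x) + 0 + c * g x + d * f x)"
    by (intro primitive_from_add primitive_from_cmult primitive_from_const
        primitive_from_mult_zero F0 G0)
  then show ?thesis
    by (simp add: algebra_simps)
qed

lemma primitive_from_power:
  assumes "primitive_from c F f"
  shows "primitive_from (c ^ Suc n) (\<lambda>x. F x ^ Suc n) (\<lambda>x. of_nat (Suc n) * F x ^ n * f x)"
proof (induction n)
  case 0
  then show ?case
    using assms by simp
next
  case (Suc n)
  from primitive_from_mult[OF assms Suc] show ?case
    by (simp add: algebra_simps)
qed

subsection \<open>Cube roots of unity and the kernel\<close>

lemma three_eq_0: "(3::3) = 0"
  by simp

lemma exhaust_012: "(k::3) = 0 \<or> k = 1 \<or> k = 2"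
  using exhaust_3[of k] by auto

lemma sum_012: "(\<Sum>k\<in>UNIV. f k) = f 0 + f 1 + f (2::3)"
  by (simp add: sum_3 three_eq_0 ac_simps)

lemma all_012: "(\<forall>k::3. P k) \<longleftrightarrow> P 0 \<and> P 1 \<and> P 2"
  by (metis exhaust_012)

lemma zeta_0 [simp]: "zeta 0 = 1"
  by (simp add: zeta_def)

lemma zeta_2: "zeta 2 = zeta 1 ^ 2"
  by (simp add: zeta_def complex_eq_iff power2_eq_square)

lemma zeta_sum: "1 + zeta 1 + zeta 2 = 0"
  by (simp add: zeta_def complex_eq_iff)

lemma zeta_cube: "zeta k ^ 3 = 1"
proof -
  have "zeta 1 ^ 3 = 1"
    by (simp add: zeta_def complex_eq_iff power3_eq_cube)
  moreover from this have "zeta 2 ^ 3 = 1"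
    unfolding zeta_2 by (metis power_commutes power_mult power_one mult.commute)
  ultimately show ?thesis
    using exhaust_012[of k] by auto
qed

lemma zeta_nonzero [simp]: "zeta k \<noteq> 0"
  using zeta_cube[of k] by auto

lemma norm_zeta [simp]: "norm (zeta k) = 1"
proof -
  have "norm (zeta k) ^ 3 = 1 ^ 3"
    by (simp add: zeta_cube flip: norm_power)
  then show ?thesis
    by (rule power_eq_imp_eq_base) auto
qed

lemma cnj_zeta: "cnj (zeta k) = zeta (- k)"
proof -
  have "cnj (zeta 1) = zeta 2" "cnj (zeta 2) = zeta 1"
    by (simp_all add: zeta_def complex_eq_iff)
  moreover have "- 1 = (2::3)" "- 2 = (1::3)"
    by simp_all
  ultimately have "cnj (zeta 1) = zeta (- 1)" "cnj (zeta 2) = zeta (- 2)"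
    by (simp_all only:)
  then show ?thesis
    using exhaust_012[of k] by auto
qed

lemma zeta_powi_minus_2: "zeta k powi (-2) = zeta k"
  using zeta_cube[of k]
  by (simp add: power_int_def power2_eq_square power3_eq_cube field_simps)

text \<open>Because zeta_k^(-2) = zeta_k, the kernel is a sum of three products, each of a function
  of x and a function of t. This separation is what turns the integral equation into amplitudes of
  plane waves.\<close>

lemma K1_eq_sum:
  assumes "lam \<noteq> 0"
  shows "K1 lam x t = (\<Sum>k\<in>UNIV. zeta k / (3 * (\<i> * lam)^2)
    * exp (\<i> * lam * zeta k * of_real x) * exp (- (\<i> * lam * zeta k * of_real t)))"
  using assms
  by (simp add: K1_def s2_def zeta_powi_minus_2 sum_distrib_left sum_divide_distrib
      algebra_simps flip: exp_add sum_negf)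

lemma norm_exp_plane_wave: "norm (exp (\<i> * lam * zeta k * of_real x)) \<le> exp (norm lam * \<bar>x\<bar>)"
  using norm_exp[of "\<i> * lam * zeta k * of_real x"] by (simp add: norm_mult)

lemma norm_exp_plane_wave_minus:
  "norm (exp (- (\<i> * lam * zeta k * of_real x))) \<le> exp (norm lam * \<bar>x\<bar>)"
  using norm_exp_plane_wave[of lam k "- x"] by simp

lemma norm_K1_le:
  assumes "lam \<noteq> 0"
  shows "norm (K1 lam x t) \<le> exp (norm lam * \<bar>x - t\<bar>) / norm lam ^ 2"
proof -
  have "norm (K1 lam x t) = norm (\<Sum>k\<in>UNIV. zeta k / (3 * (\<i> * lam)^2)
      * exp (\<i> * lam * zeta k * of_real (x - t)))"
    using assms by (simp add: K1_eq_sum algebra_simps flip: exp_add)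
  also have "\<dots> \<le> (\<Sum>k\<in>(UNIV::3 set). exp (norm lam * \<bar>x - t\<bar>) / (3 * norm lam ^ 2))"
    using norm_exp_plane_wave[of lam _ "x - t"]
    by (intro sum_norm_le) (simp add: norm_mult norm_divide norm_power divide_right_mono)
  finally show ?thesis
    by (simp add: sum_012)
qed

lemma K1_measurable [measurable (raw)]:
  assumes [measurable]: "f \<in> borel_measurable M" "g \<in> borel_measurable M"
  shows "(\<lambda>x. K1 lam (f x) (g x)) \<in> borel_measurable M"
proof (cases "lam = 0")
  case True
  then show ?thesis
    by (simp add: K1_def)
next
  case False
  show ?thesis
    unfolding K1_eq_sum[OF False] by measurable
qed

section \<open>Change of measure and termwise integration of dominated series\<close>

lemma set_integral_lebesgue_eq_lborel:
  fixes f :: "real \<Rightarrow> 'a::{banach, second_countable_topology}"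
  assumes [measurable]: "f \<in> borel_measurable borel" "A \<in> sets borel"
  shows "(LINT t:A|lebesgue. f t) = (LINT t:A|lborel. f t)"
  unfolding set_lebesgue_integral_def by (rule integral_completion) simp

lemma norm_integral_le:
  fixes f :: "'a \<Rightarrow> 'b::{banach, second_countable_topology}"
  assumes "integrable M g" "\<And>x. norm (f x) \<le> g x"
  shows "norm (\<integral>x. f x \<partial>M) \<le> (\<integral>x. g x \<partial>M)"
  using integral_norm_bound[of M f]
    integral_mono'[OF assms(1), of "\<lambda>x. norm (f x)"] assms(2) norm_ge_zero order_trans
  by metis

lemma sums_integral_dominated:
  fixes f :: "nat \<Rightarrow> 'a \<Rightarrow> 'b::{banach, second_countable_topology}"
  assumes [measurable]: "\<And>n. f n \<in> borel_measurable M"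
    and g: "integrable M g" and b: "summable b"
    and le: "\<And>n x. norm (f n x) \<le> b n * g x"
  shows "(\<lambda>n. \<integral>x. f n x \<partial>M) sums (\<integral>x. (\<Sum>n. f n x) \<partial>M)"
proof (rule sums_integral)
  have int: "integrable M (\<lambda>x. b n * g x)" for n
    using g by simp
  show f: "integrable M (f n)" for n
    by (rule Bochner_Integration.integrable_bound[OF int])
      (auto intro!: AE_I2 order_trans[OF le abs_ge_self])
  have "summable (\<lambda>n. norm (f n x))" for x
    by (rule summable_comparison_test'[OF summable_mult2[OF b, of "g x"]]) (simp add: le)
  then show "AE x in M. summable (\<lambda>n. norm (f n x))"
    by simp
  show "summable (\<lambda>n. \<integral>x. norm (f n x) \<partial>M)"
  proof (rule summable_comparison_test'[OF summable_mult2[OF b, of "\<integral>x. g x \<partial>M"]])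
    fix n :: nat
    have "(\<integral>x. norm (f n x) \<partial>M) \<le> (\<integral>x. b n * g x \<partial>M)"
      using f int le by (intro integral_mono) auto
    then show "norm (\<integral>x. norm (f n x) \<partial>M) \<le> b n * (\<integral>x. g x \<partial>M)"
      by simp
  qed
qed

subsection \<open>The Volterra series at minus infinity\<close>

text \<open>The exponent 2 |lam| accounts for two factors exp(|lam| |t|): one from the growth of the
  kernel, one from the function it is applied to.\<close>

locale borel_potential =
  fixes q :: "real \<Rightarrow> real" and lam :: complex
  assumes q_borel [measurable]: "q \<in> borel_measurable borel"
    and lam_nonzero: "lam \<noteq> 0"
    and q_weighted: "integrable lborel (\<lambda>t. \<bar>q t\<bar> * exp (2 * norm lam * \<bar>t\<bar>))"
begin

definition M :: real where "M = 1 / norm lam ^ 2"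
definition p :: "real \<Rightarrow> real" where "p t = \<bar>q t\<bar> * exp (2 * norm lam * \<bar>t\<bar>)"
definition P :: real where "P = (\<integral>t. p t \<partial>lborel)"
definition Q :: real where "Q = (\<integral>t. \<bar>q t\<bar> \<partial>lborel)"
definition G :: "real \<Rightarrow> real" where "G x = (LINT t:{..x}|lborel. \<bar>q t\<bar>)"
text \<open>The (n+1)-st kernel contains n + 1 factors K1, each contributing \<open>M\<close>, and
  an integral of n factors |q| over ordered points, which is at most Q^n / n!.\<close>

definition b :: "nat \<Rightarrow> real" where "b n = M * ((M * Q) ^ n / fact n)"

lemma M_pos: "M > 0"
  using lam_nonzero by (simp add: M_def)

lemma K1_le: "norm (K1 lam x t) \<le> M * exp (norm lam * \<bar>x - t\<bar>)"
  using norm_K1_le[OF lam_nonzero] by (simp add: M_def)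

lemma q_integrable: "integrable lborel (\<lambda>t. \<bar>q t\<bar>)"
  by (rule Bochner_Integration.integrable_bound[OF q_weighted])
    (auto intro!: AE_I2 mult_le_cancel_left1[THEN iffD2] simp: mult_le_cancel_left1)

lemma G_mono: "t \<le> x \<Longrightarrow> G t \<le> G x"
  unfolding G_def set_lebesgue_integral_def
  using q_integrable
  by (intro integral_mono integrable_mult_indicator) (auto simp: indicator_def)

lemma G_diff_le: "G x - G t \<le> Q"
proof -
  have "G x \<le> Q"
    unfolding G_def Q_def set_lebesgue_integral_def
    using q_integrable by (intro integral_mono integrable_mult_indicator) (auto simp: indicator_def)
  moreover have "0 \<le> G t"
    unfolding G_def set_lebesgue_integral_def by (intro integral_nonneg_AE) auto
  ultimately show ?thesis
    by simp
qed

lemma Q_nonneg: "0 \<le> Q"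
  unfolding Q_def by (intro integral_nonneg_AE) auto

lemma G_primitive: "primitive_from 0 G (\<lambda>t. \<bar>q t\<bar>)"
  using q_integrable by (simp add: primitive_from_def G_def)

text \<open>This is the source of the factorial in the bound of the iterated kernels.\<close>

lemma G_power:
  shows "integrable lborel (\<lambda>s. (G x - G s) ^ n * \<bar>q s\<bar>)"
    and "t \<le> x \<Longrightarrow> (LINT s:{t<..x}|lborel. (G x - G s) ^ n * \<bar>q s\<bar>) = (G x - G t) ^ Suc n / Suc n"
proof -
  have "primitive_from (G x + (-1) * 0) (\<lambda>t. G x + (-1) * G t) (\<lambda>t. 0 + (-1) * \<bar>q t\<bar>)"
    by (intro primitive_from_add primitive_from_const primitive_from_cmult G_primitive)
  \<comment> \<open>The factor -1/(n+1) cancels the n + 1 and the sign that the power rule produces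
    from the density -|q| of G(x) - G.\<close>
  from primitive_from_cmult[OF primitive_from_power[OF this, of n], of "- 1 / real (Suc n)"]
  have *: "primitive_from (- (G x ^ Suc n / Suc n)) (\<lambda>t. - ((G x - G t) ^ Suc n / Suc n))
      (\<lambda>t. (G x - G t) ^ n * \<bar>q t\<bar>)"
    by (simp del: of_nat_Suc power_Suc)
  then show int: "integrable lborel (\<lambda>s. (G x - G s) ^ n * \<bar>q s\<bar>)"
    by (simp add: primitive_from_def)
  assume "t \<le> x"
  have eq: "(LINT s:{..y}|lborel. (G x - G s) ^ n * \<bar>q s\<bar>)
      = G x ^ Suc n / Suc n - (G x - G y) ^ Suc n / Suc n" for y
  proof -
    have "- ((G x - G y) ^ Suc n / Suc n)
        = - (G x ^ Suc n / Suc n) + (LINT s:{..y}|lborel. (G x - G s) ^ n * \<bar>q s\<bar>)"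
      using * unfolding primitive_from_def by blast
    then show ?thesis
      by linarith
  qed
  have si: "set_integrable lborel A (\<lambda>s. (G x - G s) ^ n * \<bar>q s\<bar>)" if "A \<in> sets borel" for A
    unfolding set_integrable_def using int that by (intro integrable_mult_indicator) auto
  \<comment> \<open>The interval is half-open so that the two pieces are disjoint.\<close>
  have "(LINT s:{..t} \<union> {t<..x}|lborel. (G x - G s) ^ n * \<bar>q s\<bar>)
      = (LINT s:{..t}|lborel. (G x - G s) ^ n * \<bar>q s\<bar>) + (LINT s:{t<..x}|lborel. (G x - G s) ^ n * \<bar>q s\<bar>)"
    by (intro set_integral_Un si) auto
  moreover have "{..t} \<union> {t<..x} = {..x}"
    using \<open>t \<le> x\<close> by auto
  ultimately show "(LINT s:{t<..x}|lborel. (G x - G s) ^ n * \<bar>q s\<bar>) = (G x - G t) ^ Suc n / Suc n"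
    using eq[of x] eq[of t] by (simp del: of_nat_Suc)
qed

text \<open>With the interval moved into an \<open>if\<close>, the parameter \<open>t\<close>
  becomes a coordinate of a jointly measurable integrand. Measurability is a premise here because
  the induction that proves it uses this form.\<close>

lemma Kminus_Suc_eq_if:
  assumes [measurable]: "Kminus q lam n x \<in> borel_measurable borel"
  shows "Kminus q lam (Suc n) x
    = (\<lambda>t. \<integral>s. (if t \<le> s \<and> s \<le> x then Kminus q lam n x s * of_real (q s) * K1 lam s t else 0) \<partial>lborel)"
proof
  fix t
  have "Kminus q lam (Suc n) x t = (LINT s:{t..x}|lborel. Kminus q lam n x s * of_real (q s) * K1 lam s t)"
    unfolding Kminus.simps by (rule set_integral_lebesgue_eq_lborel) simp_all
  also have "\<dots> = (\<integral>s. (if t \<le> s \<and> s \<le> x then Kminus q lam n x s * of_real (q s) * K1 lam s t else 0) \<partial>lborel)"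
    unfolding set_lebesgue_integral_def
    by (rule Bochner_Integration.integral_cong) auto
  finally show "Kminus q lam (Suc n) x t = \<dots>" .
qed

lemma Kminus_measurable [measurable]: "Kminus q lam n x \<in> borel_measurable borel"
proof (induction n)
  case 0
  then show ?case by simp
next
  case (Suc n)
  note [measurable] = Suc
  show ?case
    unfolding Kminus_Suc_eq_if[OF Suc] by measurable
qed

lemmas Kminus_Suc_eq = Kminus_Suc_eq_if[OF Kminus_measurable]

text \<open>The exponentials telescope, (x - s) + (s - t) = x - t, so the growth rate does not
  accumulate with n. What remains under the integral is (G(x) - G(s))^n |q(s)|, which
  \<open>G_power\<close> evaluates.\<close>

lemma Kminus_le:
  assumes "t \<le> x"
  shows "norm (Kminus q lam n x t)
    \<le> M ^ Suc n * exp (norm lam * (x - t)) * ((G x - G t) ^ n / fact n)"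
  using assms
proof (induction n arbitrary: t)
  case 0
  then show ?case using K1_le[of x t] by simp
next
  case (Suc n)
  define C where "C = M ^ Suc (Suc n) * exp (norm lam * (x - t)) / fact n"
  have C: "C \<ge> 0"
    using M_pos by (simp add: C_def)
  have "norm (Kminus q lam (Suc n) x t)
      \<le> (\<integral>s. C * (indicator {t..x} s *\<^sub>R ((G x - G s) ^ n * \<bar>q s\<bar>)) \<partial>lborel)"
    unfolding Kminus_Suc_eq
  proof (rule norm_integral_le)
    show "integrable lborel (\<lambda>s. C * (indicator {t..x} s *\<^sub>R ((G x - G s) ^ n * \<bar>q s\<bar>)))"
      by (intro integrable_mult_right integrable_mult_indicator G_power) auto
    fix s
    show "norm (if t \<le> s \<and> s \<le> x then Kminus q lam n x s * of_real (q s) * K1 lam s t else 0)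
      \<le> C * (indicator {t..x} s *\<^sub>R ((G x - G s) ^ n * \<bar>q s\<bar>))"
    proof (cases "t \<le> s \<and> s \<le> x")
      case True
      have "norm (Kminus q lam n x s * of_real (q s) * K1 lam s t)
          \<le> (M ^ Suc n * exp (norm lam * (x - s)) * ((G x - G s) ^ n / fact n)) * \<bar>q s\<bar>
            * (M * exp (norm lam * (s - t)))"
        unfolding norm_mult norm_of_real
        using Suc.IH[of s] K1_le[of s t] True M_pos G_mono[of s x]
        by (intro mult_mono) auto
      also have "\<dots> = C * ((G x - G s) ^ n * \<bar>q s\<bar>)"
        by (simp add: C_def algebra_simps flip: exp_add)
      finally show ?thesis
        using True by simp
    qed auto
  qed
  also have "\<dots> = C * (LINT s:{t<..x}|lborel. (G x - G s) ^ n * \<bar>q s\<bar>)"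
  proof -
    have [measurable]: "G \<in> borel_measurable borel"
      using G_primitive by measurable
    have "(\<integral>s. indicator {t..x} s *\<^sub>R ((G x - G s) ^ n * \<bar>q s\<bar>) \<partial>lborel)
      = (LINT s:{t<..x}|lborel. (G x - G s) ^ n * \<bar>q s\<bar>)"
      unfolding set_lebesgue_integral_def
    proof (rule integral_cong_AE)
      show "AE s in lborel. indicator {t..x} s *\<^sub>R ((G x - G s) ^ n * \<bar>q s\<bar>)
        = indicator {t<..x} s *\<^sub>R ((G x - G s) ^ n * \<bar>q s\<bar>)"
        using AE_lborel_singleton[of t] by eventually_elim (auto simp: indicator_def)
    qed measurable
    then show ?thesis by simp
  qed
  also have "\<dots> = M ^ Suc (Suc n) * exp (norm lam * (x - t)) * ((G x - G t) ^ Suc n / fact (Suc n))"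
    unfolding G_power(2)[OF Suc.prems] C_def fact_Suc
    by (simp only: times_divide_times_eq times_divide_eq_right times_divide_eq_left divide_divide_eq_left mult_ac)
  finally show ?case .
qed

lemma b_nonneg: "0 \<le> b n"
  using M_pos Q_nonneg by (simp add: b_def)

lemma b_summable: "summable b"
  unfolding b_def using summable_exp_generic[of "M * Q"]
  by (intro summable_mult) (simp add: divide_inverse mult.commute)

lemma exp_diff_le: "exp (norm lam * (x - t)) \<le> exp (norm lam * \<bar>x\<bar>) * exp (norm lam * \<bar>t\<bar>)"
  by (simp add: mult_left_mono flip: exp_add distrib_left)

text \<open>A weaker bound in which x and t are separated, so that the t-factor can be absorbed by
  the weight and the n-dependence is a summable constant.\<close>

lemma Kminus_le':
  assumes "t \<le> x"
  shows "norm (Kminus q lam n x t) \<le> b n * (exp (norm lam * \<bar>x\<bar>) * exp (norm lam * \<bar>t\<bar>))"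
proof -
  have "norm (Kminus q lam n x t) \<le> M ^ Suc n * exp (norm lam * (x - t)) * ((G x - G t) ^ n / fact n)"
    by (rule Kminus_le[OF assms])
  also have "\<dots> \<le> M ^ Suc n * (exp (norm lam * \<bar>x\<bar>) * exp (norm lam * \<bar>t\<bar>)) * (Q ^ n / fact n)"
    using M_pos G_mono[OF assms] G_diff_le[of x t] exp_diff_le
    by (intro mult_mono divide_right_mono power_mono) auto
  finally show ?thesis
    by (simp add: b_def power_mult_distrib mult_ac)
qed


section \<open>Volterra operators on functions of exponential growth\<close>

lemma p_integrable: "integrable lborel p"
  using q_weighted unfolding p_def .

lemma p_eq: "p t = exp (norm lam * \<bar>t\<bar>) * \<bar>q t\<bar> * exp (norm lam * \<bar>t\<bar>)"
  by (simp add: p_def algebra_simps flip: exp_add)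

definition W :: "nat \<Rightarrow> (real \<Rightarrow> complex) \<Rightarrow> real \<Rightarrow> complex" where
  "W n f x = (LINT t:{..x}|lborel. Kminus q lam n x t * of_real (q t) * f t)"

lemma W_integrand_le:
  assumes "\<And>t. norm (f t) \<le> L * exp (norm lam * \<bar>t\<bar>)"
  shows "norm (indicator {..x} t *\<^sub>R (Kminus q lam n x t * of_real (q t) * f t))
    \<le> b n * (exp (norm lam * \<bar>x\<bar>) * L * p t)"
proof -
  have L: "0 \<le> L"
    using order_trans[OF norm_ge_zero assms[of 0]] by simp
  show ?thesis
  proof (cases "t \<le> x")
    case True
    have "norm (Kminus q lam n x t * of_real (q t) * f t)
        \<le> (b n * (exp (norm lam * \<bar>x\<bar>) * exp (norm lam * \<bar>t\<bar>))) * \<bar>q t\<bar> * (L * exp (norm lam * \<bar>t\<bar>))"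
      unfolding norm_mult norm_of_real
      using Kminus_le'[OF True, of n] assms[of t] b_nonneg by (intro mult_mono) auto
    then show ?thesis
      using True by (simp add: p_eq mult_ac)
  next
    case False
    then show ?thesis
      using L b_nonneg by (simp add: p_def)
  qed
qed

text \<open>Half of the weight in \<open>p\<close> absorbs the growth of the kernel in t, the other
  half that of \<open>f\<close>. The result again grows at most like exp(|lam| |x|), so the
  operators can be iterated on this class.\<close>

lemma W_le:
  assumes "\<And>t. norm (f t) \<le> L * exp (norm lam * \<bar>t\<bar>)"
  shows "norm (W n f x) \<le> b n * L * P * exp (norm lam * \<bar>x\<bar>)"
proof -
  have "norm (W n f x) \<le> (\<integral>t. b n * (exp (norm lam * \<bar>x\<bar>) * L * p t) \<partial>lborel)"
    unfolding W_def set_lebesgue_integral_def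
    by (intro norm_integral_le W_integrand_le assms integrable_mult_right p_integrable)
  then show ?thesis
    by (simp add: P_def mult_ac)
qed

lemma W_0_measurable:
  assumes [measurable]: "f \<in> borel_measurable borel"
  shows "W 0 f \<in> borel_measurable borel"
proof -
  have "W 0 f = (\<lambda>x. \<integral>t. (if t \<le> x then K1 lam x t * of_real (q t) * f t else 0) \<partial>lborel)"
    unfolding W_def set_lebesgue_integral_def
    by (intro ext) (auto intro!: Bochner_Integration.integral_cong)
  also have "\<dots> \<in> borel_measurable borel"
    by measurable
  finally show ?thesis .
qed

text \<open>
  The kernels are built by appending \<^const>\<open>K1\<close> on the right; Fubini makes the associated operators
  powers of the Volterra operator \<open>W 0\<close>, so it may be split off on the left as well.
\<close>

lemma W_Suc:
  assumes [measurable]: "f \<in> borel_measurable borel"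
    and f: "\<And>t. norm (f t) \<le> L * exp (norm lam * \<bar>t\<bar>)"
  shows "W (Suc n) f x = W n (W 0 f) x"
proof -
  define h where "h = (\<lambda>s t. if t \<le> s \<and> s \<le> x
    then Kminus q lam n x s * of_real (q s) * K1 lam s t * of_real (q t) * f t else 0)"
  have L: "0 \<le> L"
    using order_trans[OF norm_ge_zero f[of 0]] by simp
  \<comment> \<open>The dominating function is a multiple of p(s) p(t): the exponentials in s come
    from \<open>Kminus\<close> and \<open>K1\<close>, those in t from \<open>K1\<close> and
    \<open>f\<close>, and each pair fills one weight.\<close>
  have h: "integrable (lborel \<Otimes>\<^sub>M lborel) (case_prod h)"
  proof (rule Bochner_Integration.integrable_bound)
    show "integrable (lborel \<Otimes>\<^sub>M lborel)
        (\<lambda>z. b n * exp (norm lam * \<bar>x\<bar>) * M * L * (case z of (s, t) \<Rightarrow> p s * p t))"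
      by (intro integrable_mult_right integrable_pair_mult p_integrable)
    show "case_prod h \<in> borel_measurable (lborel \<Otimes>\<^sub>M lborel)"
      unfolding h_def split_beta' by measurable
    have "norm (h s t) \<le> b n * exp (norm lam * \<bar>x\<bar>) * M * L * (p s * p t)" for s t
    proof (cases "t \<le> s \<and> s \<le> x")
      case True
      have "norm (h s t) = norm (Kminus q lam n x s) * \<bar>q s\<bar> * norm (K1 lam s t) * \<bar>q t\<bar> * norm (f t)"
        using True by (simp add: h_def norm_mult)
      also have "\<dots> \<le> (b n * (exp (norm lam * \<bar>x\<bar>) * exp (norm lam * \<bar>s\<bar>))) * \<bar>q s\<bar>
          * (M * (exp (norm lam * \<bar>s\<bar>) * exp (norm lam * \<bar>t\<bar>))) * \<bar>q t\<bar> * (L * exp (norm lam * \<bar>t\<bar>))"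
      proof -
        have "norm (K1 lam s t) \<le> M * (exp (norm lam * \<bar>s\<bar>) * exp (norm lam * \<bar>t\<bar>))"
          using True M_pos exp_diff_le[of s t]
          by (intro order_trans[OF K1_le]) (auto simp: mult_left_mono)
        then show ?thesis
          using Kminus_le'[of s x n] f[of t] True b_nonneg M_pos L
          by (intro mult_mono) auto
      qed
      finally show ?thesis
        by (simp add: p_eq mult_ac)
    next
      case False
      then show ?thesis
        using b_nonneg M_pos L by (auto simp: h_def p_def)
    qed
    then have "norm (h s t) \<le> norm (b n * exp (norm lam * \<bar>x\<bar>) * M * L * (p s * p t))" for s t
      by (rule order_trans) simp
    then show "AE z in lborel \<Otimes>\<^sub>M lborel. norm (case z of (s, t) \<Rightarrow> h s t)
        \<le> norm (b n * exp (norm lam * \<bar>x\<bar>) * M * L * (case z of (s, t) \<Rightarrow> p s * p t))"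
      by (intro AE_I2) (simp add: split_beta')
  qed
  have "W (Suc n) f x = (\<integral>t. (\<integral>s. h s t \<partial>lborel) \<partial>lborel)"
    unfolding W_def set_lebesgue_integral_def
  proof (rule Bochner_Integration.integral_cong[OF refl])
    fix t
    have "Kminus q lam (Suc n) x t * (of_real (q t) * f t) = (\<integral>s. h s t \<partial>lborel)"
      unfolding Kminus_Suc_eq h_def
      by (subst integral_mult_left_zero [symmetric], rule Bochner_Integration.integral_cong) auto
    moreover have "t > x \<Longrightarrow> (\<lambda>s. h s t) = (\<lambda>s. 0)"
      by (auto simp: h_def)
    ultimately show "indicator {..x} t *\<^sub>R (Kminus q lam (Suc n) x t * of_real (q t) * f t)
        = (\<integral>s. h s t \<partial>lborel)"
      by (cases "t \<le> x") (simp_all del: Kminus.simps add: mult.assoc)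
  qed
  also have "\<dots> = (\<integral>s. (\<integral>t. h s t \<partial>lborel) \<partial>lborel)"
    by (rule lborel_pair.Fubini_integral[OF h])
  also have "\<dots> = W n (W 0 f) x"
    unfolding W_def[of n] set_lebesgue_integral_def
  proof (rule Bochner_Integration.integral_cong[OF refl])
    fix s
    have "s \<le> x \<Longrightarrow> (\<integral>t. h s t \<partial>lborel) = Kminus q lam n x s * of_real (q s) * W 0 f s"
      unfolding W_def set_lebesgue_integral_def h_def
      by (subst integral_mult_right_zero [symmetric])
        (auto intro!: Bochner_Integration.integral_cong)
    moreover have "s > x \<Longrightarrow> h s = (\<lambda>t. 0)"
      by (auto simp: h_def)
    ultimately show "(\<integral>t. h s t \<partial>lborel)
        = indicator {..x} s *\<^sub>R (Kminus q lam n x s * of_real (q s) * W 0 f s)"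
      by (cases "s \<le> x") simp_all
  qed
  finally show ?thesis .
qed

text \<open>Induction over all admissible \<open>f\<close>, applied to \<open>W 0 f\<close>,
  converts a factor split off on the right into one on the left. Measurability is part of the same
  induction: only \<open>W 0\<close> has a kernel known to be jointly measurable, and the higher
  operators inherit the property by composition.\<close>

lemma W_measurable_and_commute:
  assumes "f \<in> borel_measurable borel"
    and "\<And>t. norm (f t) \<le> L * exp (norm lam * \<bar>t\<bar>)"
  shows "W n f \<in> borel_measurable borel \<and> W (Suc n) f = W 0 (W n f)"
  using assms
proof (induction n arbitrary: f L)
  case 0
  then show ?case
    using W_Suc[OF 0] W_0_measurable by blast
next
  case (Suc n)
  have 1: "W 0 f \<in> borel_measurable borel"
    using Suc.prems by (intro W_0_measurable)
  have 2: "norm (W 0 f t) \<le> (b 0 * L * P) * exp (norm lam * \<bar>t\<bar>)" for t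
    by (rule W_le[OF Suc.prems(2)])
  have 3: "W (Suc m) f = W m (W 0 f)" for m
    using W_Suc[OF Suc.prems] by blast
  show ?case
    using Suc.IH[OF 1 2] by (simp add: 3)
qed

end

subsection \<open>Amplitudes and their invariants\<close>

text \<open>Inserting the expansion of \<open>y\<close> into the densities gives a closed linear
  system for \<open>c\<close>, with limits \<open>c0\<close> at minus infinity. The differential
  equation is thus encoded without any derivative of \<open>y\<close>.\<close>

definition amplitudes ::
  "(real \<Rightarrow> real) \<Rightarrow> complex \<Rightarrow> (3 \<Rightarrow> complex) \<Rightarrow> (3 \<Rightarrow> real \<Rightarrow> complex) \<Rightarrow> (real \<Rightarrow> complex) \<Rightarrow> bool"
  where "amplitudes q lam c0 c y \<longleftrightarrow>
    (\<forall>l. primitive_from (c0 l) (c l) (\<lambda>t. \<i> * zeta l / (3 * (\<i> * lam)^2)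
      * exp (- (\<i> * lam * zeta l * of_real t)) * of_real (q t) * y t)) \<and>
    (\<forall>t. y t = (\<Sum>l\<in>UNIV. c l t * exp (\<i> * lam * zeta l * of_real t)))"

definition coef_u :: "(real \<Rightarrow> real) \<Rightarrow> complex \<Rightarrow> 3 \<Rightarrow> 3 \<Rightarrow> real \<Rightarrow> complex" where
  "coef_u q lam k l x = (if k = l then 1 else 0)
    + (LINT t:{..x}|lborel. \<i> * zeta l / (3 * (\<i> * lam)^2)
      * exp (- (\<i> * lam * zeta l * of_real t)) * of_real (q t) * jost_u q k lam t)"

lemma amplitudes_primitive:
  assumes "amplitudes q lam c0 c y"
  shows "primitive_from (c0 l) (c l) (\<lambda>t. \<i> * zeta l / (3 * (\<i> * lam)^2)
    * exp (- (\<i> * lam * zeta l * of_real t)) * of_real (q t) * y t)"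
  using assms unfolding amplitudes_def by blast

lemma amplitudes_expand:
  assumes "amplitudes q lam c0 c y"
  shows "y t = (\<Sum>l\<in>UNIV. c l t * exp (\<i> * lam * zeta l * of_real t))"
  using assms unfolding amplitudes_def by blast

section \<open>Neumann series, integral equation and amplitudes of the Jost solutions at minus
  infinity\<close>

context borel_potential
begin

definition e :: "3 \<Rightarrow> real \<Rightarrow> complex" where "e k t = exp (\<i> * lam * zeta k * of_real t)"

text \<open>The n-th Neumann iterate without its power of \<i>. The shift arises because
  \<open>W m\<close> carries the kernel with m + 1 factors \<open>K1\<close>, while index 0 is the
  free wave.\<close>

definition w :: "3 \<Rightarrow> nat \<Rightarrow> real \<Rightarrow> complex" where
  "w k n = (case n of 0 \<Rightarrow> e k | Suc m \<Rightarrow> W m (e k))"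

definition w_bound :: "nat \<Rightarrow> real" where
  "w_bound n = (case n of 0 \<Rightarrow> 1 | Suc m \<Rightarrow> b m * P)"

lemma e_measurable [measurable]: "e k \<in> borel_measurable borel"
  unfolding e_def by measurable

lemma e_le: "norm (e k t) \<le> 1 * exp (norm lam * \<bar>t\<bar>)"
  using norm_exp_plane_wave by (simp add: e_def)

lemma w_measurable [measurable]: "w k n \<in> borel_measurable borel"
  using W_measurable_and_commute[OF e_measurable e_le] by (cases n) (simp_all add: w_def)

lemma w_Suc: "w k (Suc n) = W 0 (w k n)"
  using W_measurable_and_commute[OF e_measurable e_le] by (cases n) (simp_all add: w_def)

lemma w_le: "norm (w k n x) \<le> w_bound n * exp (norm lam * \<bar>x\<bar>)"
  using W_le[OF e_le] e_le by (cases n) (simp_all add: w_def w_bound_def)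

lemma w_bound_summable: "summable w_bound"
  by (subst summable_Suc_iff [symmetric])
    (simp add: w_bound_def b_summable summable_mult2)

lemma w_summable: "summable (\<lambda>n. \<i> ^ n * w k n x)"
  using w_le[of k _ x]
  by (intro summable_comparison_test'[OF summable_mult2[OF w_bound_summable, of "exp (norm lam * \<bar>x\<bar>)"]])
    (simp add: norm_mult norm_power)

lemma Nminus_summable:
  assumes "t \<le> x"
  shows "summable (\<lambda>n. \<i> ^ Suc n * Kminus q lam n x t)"
  using Kminus_le'[OF assms]
  by (intro summable_comparison_test'[OF summable_mult2[OF b_summable,
        of "exp (norm lam * \<bar>x\<bar>) * exp (norm lam * \<bar>t\<bar>)"]])
    (simp add: norm_mult norm_power)

text \<open>The series defining \<open>Nminus\<close> is integrated term by term, dominated by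
  \<open>b n\<close> times a multiple of \<open>p\<close>; the free wave then joins as the term of
  index 0.\<close>

lemma jost_u_eq_suminf: "jost_u q k lam x = (\<Sum>n. \<i> ^ n * w k n x)"
proof -
  define f where "f = (\<lambda>n t. \<i> ^ Suc n * (indicator {..x} t *\<^sub>R (Kminus q lam n x t * of_real (q t) * e k t)))"
  have f_sum: "indicator {..x} t *\<^sub>R (Nminus q lam x t * of_real (q t) * e k t) = (\<Sum>n. f n t)" for t
  proof (cases "t \<le> x")
    case True
    from suminf_mult2[OF Nminus_summable[OF True], of "of_real (q t) * e k t"] show ?thesis
      using True by (simp add: Nminus_def f_def mult_ac)
  qed (simp add: f_def)
  have "(LINT t:{..x}|lebesgue. Nminus q lam x t * of_real (q t) * exp (\<i> * lam * zeta k * of_real t))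
      = (LINT t:{..x}|lborel. Nminus q lam x t * of_real (q t) * e k t)"
    unfolding e_def by (rule set_integral_lebesgue_eq_lborel) (simp_all add: Nminus_def)
  also have "\<dots> = (\<integral>t. (\<Sum>n. f n t) \<partial>lborel)"
    unfolding set_lebesgue_integral_def f_sum ..
  finally have "jost_u q k lam x = w k 0 x + (\<integral>t. (\<Sum>n. f n t) \<partial>lborel)"
    by (simp add: jost_u_def w_def e_def)
  moreover have "(\<lambda>n. \<integral>t. f n t \<partial>lborel) sums (\<integral>t. (\<Sum>n. f n t) \<partial>lborel)"
  proof (rule sums_integral_dominated)
    show "f n \<in> borel_measurable lborel" for n
      unfolding f_def by measurable
    show "integrable lborel (\<lambda>t. exp (norm lam * \<bar>x\<bar>) * 1 * p t)"
      by (intro integrable_mult_right p_integrable)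
    show "norm (f n t) \<le> b n * (exp (norm lam * \<bar>x\<bar>) * 1 * p t)" for n t
      using W_integrand_le[OF e_le[of k], where n = n and x = x and t = t] by (simp add: f_def norm_mult norm_power)
  qed (rule b_summable)
  moreover have "(\<integral>t. f n t \<partial>lborel) = \<i> ^ Suc n * w k (Suc n) x" for n
    unfolding f_def by (subst integral_mult_right_zero) (simp add: w_def W_def set_lebesgue_integral_def)
  ultimately have "(\<lambda>n. \<i> ^ Suc n * w k (Suc n) x) sums (jost_u q k lam x - w k 0 x)"
    by simp
  then have "(\<lambda>n. \<i> ^ n * w k n x) sums (jost_u q k lam x)"
    by (subst (asm) sums_Suc_iff) simp
  then show ?thesis
    by (rule sums_unique)
qed

lemma jost_u_measurable [measurable]: "jost_u q k lam \<in> borel_measurable borel"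
proof -
  have "jost_u q k lam = (\<lambda>x. \<Sum>n. \<i> ^ n * w k n x)"
    using jost_u_eq_suminf by blast
  also have "\<dots> \<in> borel_measurable borel"
    by measurable
  finally show ?thesis .
qed

lemma jost_u_le: "norm (jost_u q k lam x) \<le> suminf w_bound * exp (norm lam * \<bar>x\<bar>)"
proof -
  have "norm (\<Sum>n. \<i> ^ n * w k n x) \<le> (\<Sum>n. w_bound n * exp (norm lam * \<bar>x\<bar>))"
    using w_le by (intro norm_suminf_le summable_mult2 w_bound_summable)
      (simp add: norm_mult norm_power)
  then show ?thesis
    using w_bound_summable by (simp add: jost_u_eq_suminf suminf_mult2)
qed

text \<open>Applying \<open>W 0\<close> termwise shifts the Neumann series by one place, by
  \<open>w_Suc\<close>; the missing term is the free wave.\<close>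

lemma jost_u_integral_eq:
  "jost_u q k lam x = e k x + \<i> * (LINT t:{..x}|lborel. K1 lam x t * of_real (q t) * jost_u q k lam t)"
proof -
  define f where "f = (\<lambda>n t. \<i> ^ n * (indicator {..x} t *\<^sub>R (K1 lam x t * of_real (q t) * w k n t)))"
  have "(\<Sum>n. f n t) = indicator {..x} t *\<^sub>R (K1 lam x t * of_real (q t) * jost_u q k lam t)" for t
    using suminf_mult[OF w_summable[of k t], of "indicator {..x} t *\<^sub>R (K1 lam x t * of_real (q t))"]
    by (simp add: f_def jost_u_eq_suminf mult_ac scaleR_conv_of_real)
  then have "(LINT t:{..x}|lborel. K1 lam x t * of_real (q t) * jost_u q k lam t)
      = (\<integral>t. (\<Sum>n. f n t) \<partial>lborel)"
    by (simp add: set_lebesgue_integral_def)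
  moreover have "(\<lambda>n. \<integral>t. f n t \<partial>lborel) sums (\<integral>t. (\<Sum>n. f n t) \<partial>lborel)"
  proof (rule sums_integral_dominated)
    show "f n \<in> borel_measurable lborel" for n
      unfolding f_def by measurable
    show "integrable lborel (\<lambda>t. b 0 * exp (norm lam * \<bar>x\<bar>) * p t)"
      by (intro integrable_mult_right p_integrable)
    show "norm (f n t) \<le> w_bound n * (b 0 * exp (norm lam * \<bar>x\<bar>) * p t)" for n t
      using W_integrand_le[OF w_le[of k n], where n = 0 and x = x and t = t] by (simp add: f_def norm_mult norm_power mult_ac)
  qed (rule w_bound_summable)
  moreover have "(\<integral>t. f n t \<partial>lborel) = \<i> ^ n * w k (Suc n) x" for n
    unfolding f_def by (subst integral_mult_right_zero) (simp add: w_Suc W_def set_lebesgue_integral_def)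
  ultimately have "(\<lambda>n. \<i> ^ n * w k (Suc n) x)
      sums (LINT t:{..x}|lborel. K1 lam x t * of_real (q t) * jost_u q k lam t)"
    by simp
  from sums_mult[OF this, of \<i>]
  have "(\<lambda>n. \<i> ^ Suc n * w k (Suc n) x)
      sums (\<i> * (LINT t:{..x}|lborel. K1 lam x t * of_real (q t) * jost_u q k lam t))"
    by (simp add: mult_ac)
  then have "(\<lambda>n. \<i> ^ n * w k n x)
      sums (\<i> * (LINT t:{..x}|lborel. K1 lam x t * of_real (q t) * jost_u q k lam t) + w k 0 x)"
    by (subst (asm) sums_Suc_iff) simp
  then have "jost_u q k lam x
      = \<i> * (LINT t:{..x}|lborel. K1 lam x t * of_real (q t) * jost_u q k lam t) + w k 0 x"
    unfolding jost_u_eq_suminf[of k x] by (rule sums_unique [symmetric])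
  then show ?thesis
    by (simp add: w_def)
qed

lemma density_integrable:
  "integrable lborel (\<lambda>t. \<i> * zeta l / (3 * (\<i> * lam)^2)
      * exp (- (\<i> * lam * zeta l * of_real t)) * of_real (q t) * jost_u q k lam t)"
proof (rule Bochner_Integration.integrable_bound)
  show "integrable lborel (\<lambda>t. M / 3 * suminf w_bound * p t)"
    by (intro integrable_mult_right p_integrable)
  show "AE t in lborel. norm (\<i> * zeta l / (3 * (\<i> * lam)^2)
      * exp (- (\<i> * lam * zeta l * of_real t)) * of_real (q t) * jost_u q k lam t)
      \<le> norm (M / 3 * suminf w_bound * p t)"
  proof (rule AE_I2)
    fix t
    have "norm (\<i> * zeta l / (3 * (\<i> * lam)^2)
        * exp (- (\<i> * lam * zeta l * of_real t)) * of_real (q t) * jost_u q k lam t)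
        = M / 3 * norm (exp (- (\<i> * lam * zeta l * of_real t))) * \<bar>q t\<bar> * norm (jost_u q k lam t)"
      by (simp add: norm_mult norm_divide norm_power M_def)
    also have "\<dots> \<le> M / 3 * exp (norm lam * \<bar>t\<bar>) * \<bar>q t\<bar> * (suminf w_bound * exp (norm lam * \<bar>t\<bar>))"
      using M_pos norm_exp_plane_wave_minus[of lam l t] jost_u_le[of k t]
      by (intro mult_mono) auto
    also have "\<dots> = M / 3 * suminf w_bound * p t"
      by (simp add: p_eq)
    also have "\<dots> \<le> norm (M / 3 * suminf w_bound * p t)"
      by simp
    finally show "norm (\<i> * zeta l / (3 * (\<i> * lam)^2)
        * exp (- (\<i> * lam * zeta l * of_real t)) * of_real (q t) * jost_u q k lam t)
      \<le> norm (M / 3 * suminf w_bound * p t)" .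
  qed
qed measurable

text \<open>The separated form of \<open>K1\<close> distributes the integral equation over the three
  plane waves, and the free wave contributes the Kronecker delta as the limits at minus
  infinity.\<close>

lemma jost_u_amplitudes:
  "amplitudes q lam (\<lambda>l. if k = l then 1 else 0) (coef_u q lam k) (jost_u q k lam)"
  unfolding amplitudes_def
proof (intro conjI allI)
  fix x
  define D where "D = (\<lambda>l t. \<i> * zeta l / (3 * (\<i> * lam)^2)
      * exp (- (\<i> * lam * zeta l * of_real t)) * of_real (q t) * jost_u q k lam t)"
  have D: "integrable lborel (\<lambda>t. indicator {..x} t *\<^sub>R D l t)" for l
    unfolding D_def by (intro integrable_mult_indicator density_integrable) auto
  have "\<i> * (LINT t:{..x}|lborel. K1 lam x t * of_real (q t) * jost_u q k lam t)
      = (\<integral>t. (\<Sum>l\<in>UNIV. e l x * (indicator {..x} t *\<^sub>R D l t)) \<partial>lborel)"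
    unfolding set_lebesgue_integral_def integral_mult_right_zero [symmetric] K1_eq_sum[OF lam_nonzero]
    by (intro Bochner_Integration.integral_cong)
      (auto simp: D_def e_def indicator_def sum_distrib_left sum_distrib_right mult_ac)
  also have "\<dots> = (\<Sum>l\<in>UNIV. e l x * (LINT t:{..x}|lborel. D l t))"
    unfolding set_lebesgue_integral_def
    by (subst Bochner_Integration.integral_sum)
      (intro integrable_mult_right D, simp only: integral_mult_right_zero)
  finally have "jost_u q k lam x = e k x + (\<Sum>l\<in>UNIV. e l x * (LINT t:{..x}|lborel. D l t))"
    by (subst jost_u_integral_eq) simp
  moreover have "e k x = (\<Sum>l\<in>UNIV. (if k = l then 1 else 0) * e l x)"
    using exhaust_012[of k] by (auto simp: sum_012)
  moreover have coef: "coef_u q lam k l x = (if k = l then 1 else 0) + (LINT t:{..x}|lborel. D l t)" for l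
    by (simp only: coef_u_def D_def)
  ultimately show "jost_u q k lam x = (\<Sum>l\<in>UNIV. coef_u q lam k l x * exp (\<i> * lam * zeta l * of_real x))"
    unfolding coef e_def [symmetric] distrib_right sum.distrib
    by (simp only: mult.commute)
qed (use density_integrable in \<open>simp add: primitive_from_def coef_u_def\<close>)

end

section \<open>Conserved quantities of the amplitude system\<close>

text \<open>Up to the factor 3 (i lam)^2 this sum is the Lagrange bracket y'' z* - y' z*' + y z*''
  (z* the complex conjugate of z) of the formally self-adjoint operator i y''' + q y, taken at the
  parameters lam^3 and its conjugate. Index k meets -k because the conjugate of the wave with index
  -k at \<open>cnj lam\<close> is the reciprocal of the wave with index k at
  \<open>lam\<close>.\<close>

lemma amplitudes_form:
  assumes c: "amplitudes q lam c0 c y" and d: "amplitudes q (cnj lam) d0 d z"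
  shows "(\<Sum>k\<in>UNIV. zeta k ^ 2 * (c k x * cnj (d (- k) x)))
    = (\<Sum>k\<in>UNIV. zeta k ^ 2 * (c0 k * cnj (d0 (- k))))"
proof -
  define f where "f = (\<lambda>l t. \<i> * zeta l / (3 * (\<i> * lam)^2)
      * exp (- (\<i> * lam * zeta l * of_real t)) * of_real (q t) * y t)"
  define g where "g = (\<lambda>l t. \<i> * zeta l / (3 * (\<i> * cnj lam)^2)
      * exp (- (\<i> * cnj lam * zeta l * of_real t)) * of_real (q t) * z t)"
  have f: "primitive_from (c0 l) (c l) (f l)" and g: "primitive_from (d0 l) (d l) (g l)" for l
    unfolding f_def g_def by (rule amplitudes_primitive[OF c], rule amplitudes_primitive[OF d])
  have prim: "primitive_from (\<Sum>k\<in>UNIV. zeta k ^ 2 * (c0 k * cnj (d0 (- k))))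
      (\<lambda>x. \<Sum>k\<in>UNIV. zeta k ^ 2 * (c k x * cnj (d (- k) x)))
      (\<lambda>x. \<Sum>k\<in>UNIV. zeta k ^ 2 * (f k x * cnj (d (- k) x) + c k x * cnj (g (- k) x)))"
    by (intro primitive_from_sum primitive_from_cmult primitive_from_mult primitive_from_cnj f g)
  have "(\<Sum>k\<in>UNIV. zeta k ^ 2 * (f k t * cnj (d (- k) t) + c k t * cnj (g (- k) t))) = 0" for t
  proof -
    define E where "E = (\<lambda>k. exp (\<i> * lam * zeta k * of_real t))"
    define A where "A = \<i> / (3 * (\<i> * lam)^2) * of_real (q t)"
    have y: "y t = (\<Sum>k\<in>UNIV. c k t * E k)"
      unfolding E_def by (rule amplitudes_expand[OF c])
    have "cnj (z t) = (\<Sum>k\<in>UNIV. cnj (d k t) * exp (- (\<i> * lam * zeta (- k) * of_real t)))"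
      by (subst amplitudes_expand[OF d]) (simp add: exp_cnj cnj_zeta)
    also have "\<dots> = (\<Sum>k\<in>UNIV. cnj (d (- k) t) / E k)"
      by (rule sum.reindex_bij_witness[of _ uminus uminus]) (auto simp: E_def exp_minus divide_inverse)
    finally have z: "cnj (z t) = (\<Sum>k\<in>UNIV. cnj (d (- k) t) / E k)" .
    have E_inv: "exp (- (\<i> * lam * zeta k * of_real t)) = 1 / E k" for k
      by (simp add: E_def exp_minus inverse_eq_divide)
    \<comment> \<open>The weight zeta_k^2 completes the zeta_k of the density to a cube, so the
      k-dependence reduces to the wave. In the conjugate term below, the opposite sign is that of
      the conjugate of \<i>, and \<open>q\<close> is unchanged because it is real.\<close>
    have fk: "zeta k ^ 2 * f k t = A * (y t / E k)" for k
    proof -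
      have "zeta k ^ 2 * f k t = zeta k ^ 3 * (A * (y t / E k))"
        unfolding f_def E_inv
        by (simp add: A_def power2_eq_square power3_eq_cube mult_ac)
      then show ?thesis by (simp add: zeta_cube)
    qed
    have gk: "zeta k ^ 2 * cnj (g (- k) t) = - A * (E k * cnj (z t))" for k
    proof -
      have "zeta k ^ 2 * cnj (g (- k) t) = zeta k ^ 3 * (- A * (E k * cnj (z t)))"
        by (simp add: g_def A_def E_def exp_cnj cnj_zeta power2_eq_square power3_eq_cube mult_ac)
      then show ?thesis by (simp add: zeta_cube)
    qed
    have "(\<Sum>k\<in>UNIV. zeta k ^ 2 * (f k t * cnj (d (- k) t) + c k t * cnj (g (- k) t)))
      = (\<Sum>k\<in>UNIV. (zeta k ^ 2 * f k t) * cnj (d (- k) t) + c k t * (zeta k ^ 2 * cnj (g (- k) t)))"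
      by (simp add: algebra_simps)
    also have "\<dots> = A * y t * (\<Sum>k\<in>UNIV. cnj (d (- k) t) / E k)
        - A * cnj (z t) * (\<Sum>k\<in>UNIV. c k t * E k)"
      unfolding fk gk
      by (simp add: sum_distrib_left sum_subtractf mult_ac)
    also have "\<dots> = 0"
      unfolding y [symmetric] z [symmetric] by (simp add: mult_ac)
    finally show ?thesis .
  qed
  with prim show ?thesis
    by (simp add: primitive_from_def)
qed

text \<open>Liouville's formula: the density of the determinant is the trace times the determinant.
  The trace is the sum of B_l E_l, in which the exponentials cancel, leaving a multiple of 1 +
  zeta_1 + zeta_2 = 0.\<close>

lemma amplitudes_det:
  assumes "\<And>j. amplitudes q lam (c0 j) (c j) (y j)"
  shows "det (\<chi> j l. c j l x) = det (\<chi> j l. c0 j (l::3))"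
proof -
  define f where "f = (\<lambda>j l t. \<i> * zeta l / (3 * (\<i> * lam)^2)
      * exp (- (\<i> * lam * zeta l * of_real t)) * of_real (q t) * y j t)"
  have f: "primitive_from (c0 j l) (c j l) (f j l)" for j l
    unfolding f_def by (rule amplitudes_primitive[OF assms])
  \<comment> \<open>The determinant is written as its six triple products in the order of
    \<open>det_3\<close> with index 3 read as 0, and signs as factors -1, so that the rules for
    primitives apply structurally.\<close>
  have prim: "primitive_from
     (c0 1 1 * c0 2 2 * c0 0 0 + c0 1 2 * c0 2 0 * c0 0 1 + c0 1 0 * c0 2 1 * c0 0 2
      + (-1) * (c0 1 1 * c0 2 0 * c0 0 2) + (-1) * (c0 1 2 * c0 2 1 * c0 0 0) + (-1) * (c0 1 0 * c0 2 2 * c0 0 1))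
     (\<lambda>x. c 1 1 x * c 2 2 x * c 0 0 x + c 1 2 x * c 2 0 x * c 0 1 x + c 1 0 x * c 2 1 x * c 0 2 x
      + (-1) * (c 1 1 x * c 2 0 x * c 0 2 x) + (-1) * (c 1 2 x * c 2 1 x * c 0 0 x) + (-1) * (c 1 0 x * c 2 2 x * c 0 1 x))
     (\<lambda>x. ((f 1 1 x * c 2 2 x + c 1 1 x * f 2 2 x) * c 0 0 x + c 1 1 x * c 2 2 x * f 0 0 x)
      + ((f 1 2 x * c 2 0 x + c 1 2 x * f 2 0 x) * c 0 1 x + c 1 2 x * c 2 0 x * f 0 1 x)
      + ((f 1 0 x * c 2 1 x + c 1 0 x * f 2 1 x) * c 0 2 x + c 1 0 x * c 2 1 x * f 0 2 x)
      + (-1) * ((f 1 1 x * c 2 0 x + c 1 1 x * f 2 0 x) * c 0 2 x + c 1 1 x * c 2 0 x * f 0 2 x)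
      + (-1) * ((f 1 2 x * c 2 1 x + c 1 2 x * f 2 1 x) * c 0 0 x + c 1 2 x * c 2 1 x * f 0 0 x)
      + (-1) * ((f 1 0 x * c 2 2 x + c 1 0 x * f 2 2 x) * c 0 1 x + c 1 0 x * c 2 2 x * f 0 1 x))"
    by (intro primitive_from_add primitive_from_cmult primitive_from_mult f)
  have deriv: "((f 1 1 t * c 2 2 t + c 1 1 t * f 2 2 t) * c 0 0 t + c 1 1 t * c 2 2 t * f 0 0 t)
      + ((f 1 2 t * c 2 0 t + c 1 2 t * f 2 0 t) * c 0 1 t + c 1 2 t * c 2 0 t * f 0 1 t)
      + ((f 1 0 t * c 2 1 t + c 1 0 t * f 2 1 t) * c 0 2 t + c 1 0 t * c 2 1 t * f 0 2 t)
      + (-1) * ((f 1 1 t * c 2 0 t + c 1 1 t * f 2 0 t) * c 0 2 t + c 1 1 t * c 2 0 t * f 0 2 t)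
      + (-1) * ((f 1 2 t * c 2 1 t + c 1 2 t * f 2 1 t) * c 0 0 t + c 1 2 t * c 2 1 t * f 0 0 t)
      + (-1) * ((f 1 0 t * c 2 2 t + c 1 0 t * f 2 2 t) * c 0 1 t + c 1 0 t * c 2 2 t * f 0 1 t) = 0"
    for t
  proof -
    define E where "E = (\<lambda>k. exp (\<i> * lam * zeta k * of_real t))"
    define A where "A = \<i> / (3 * (\<i> * lam)^2) * of_real (q t)"
    define B where "B = (\<lambda>l. A * zeta l / E l)"
    have y: "y j t = c j 0 t * E 0 + c j 1 t * E 1 + c j 2 t * E 2" for j
      by (subst amplitudes_expand[OF assms]) (simp add: E_def sum_012)
    have E_inv: "exp (- (\<i> * lam * zeta k * of_real t)) = 1 / E k" for k
      by (simp add: E_def exp_minus inverse_eq_divide)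
    have fB: "f j l t = B l * y j t" for j l
      unfolding f_def E_inv by (simp add: A_def B_def mult_ac)
    have "B 0 * E 0 + B 1 * E 1 + B 2 * E 2 = A * (1 + zeta 1 + zeta 2)"
      by (simp add: B_def E_def algebra_simps)
    then have BE: "B 0 * E 0 + B 1 * E 1 + B 2 * E 2 = 0"
      by (simp add: zeta_sum)
    have "((f 1 1 t * c 2 2 t + c 1 1 t * f 2 2 t) * c 0 0 t + c 1 1 t * c 2 2 t * f 0 0 t)
      + ((f 1 2 t * c 2 0 t + c 1 2 t * f 2 0 t) * c 0 1 t + c 1 2 t * c 2 0 t * f 0 1 t)
      + ((f 1 0 t * c 2 1 t + c 1 0 t * f 2 1 t) * c 0 2 t + c 1 0 t * c 2 1 t * f 0 2 t)
      + (-1) * ((f 1 1 t * c 2 0 t + c 1 1 t * f 2 0 t) * c 0 2 t + c 1 1 t * c 2 0 t * f 0 2 t)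
      + (-1) * ((f 1 2 t * c 2 1 t + c 1 2 t * f 2 1 t) * c 0 0 t + c 1 2 t * c 2 1 t * f 0 0 t)
      + (-1) * ((f 1 0 t * c 2 2 t + c 1 0 t * f 2 2 t) * c 0 1 t + c 1 0 t * c 2 2 t * f 0 1 t)
      = (B 0 * E 0 + B 1 * E 1 + B 2 * E 2) *
        (c 1 1 t * c 2 2 t * c 0 0 t + c 1 2 t * c 2 0 t * c 0 1 t + c 1 0 t * c 2 1 t * c 0 2 t
        - c 1 1 t * c 2 0 t * c 0 2 t - c 1 2 t * c 2 1 t * c 0 0 t - c 1 0 t * c 2 2 t * c 0 1 t)"
      unfolding fB y by (simp add: algebra_simps)
    then show ?thesis
      by (simp only: BE mult_zero_left)
  qed
  show ?thesis
    using prim unfolding deriv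
    by (simp add: primitive_from_def set_lebesgue_integral_def det_3 three_eq_0)
qed

lemma amplitudes_sum:
  assumes "\<And>j. amplitudes q lam (c0 j) (c j) (y j)"
  shows "amplitudes q lam (\<lambda>l. \<Sum>j\<in>I. a j * c0 j l) (\<lambda>l x. \<Sum>j\<in>I. a j * c j l x) (\<lambda>x. \<Sum>j\<in>I. a j * y j x)"
  unfolding amplitudes_def
proof (intro conjI allI)
  fix l
  have "primitive_from (\<Sum>j\<in>I. a j * c0 j l) (\<lambda>x. \<Sum>j\<in>I. a j * c j l x)
    (\<lambda>t. \<Sum>j\<in>I. a j * (\<i> * zeta l / (3 * (\<i> * lam)^2)
      * exp (- (\<i> * lam * zeta l * of_real t)) * of_real (q t) * y j t))"
    by (intro primitive_from_sum primitive_from_cmult amplitudes_primitive[OF assms])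
  then show "primitive_from (\<Sum>j\<in>I. a j * c0 j l) (\<lambda>x. \<Sum>j\<in>I. a j * c j l x)
    (\<lambda>t. \<i> * zeta l / (3 * (\<i> * lam)^2)
      * exp (- (\<i> * lam * zeta l * of_real t)) * of_real (q t) * (\<Sum>j\<in>I. a j * y j t))"
    by (simp add: sum_distrib_left sum_distrib_right sum_divide_distrib mult_ac)
next
  fix t
  have "(\<Sum>j\<in>I. a j * y j t) = (\<Sum>j\<in>I. \<Sum>l\<in>UNIV. a j * c j l t * exp (\<i> * lam * zeta l * of_real t))"
    by (simp add: amplitudes_expand[OF assms] sum_distrib_left mult.assoc)
  also have "\<dots> = (\<Sum>l\<in>UNIV. \<Sum>j\<in>I. a j * c j l t * exp (\<i> * lam * zeta l * of_real t))"
    by (rule sum.swap)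
  finally show "(\<Sum>j\<in>I. a j * y j t)
      = (\<Sum>l\<in>UNIV. (\<Sum>j\<in>I. a j * c j l t) * exp (\<i> * lam * zeta l * of_real t))"
    by (simp add: sum_distrib_right)
qed

section \<open>Independence, and reflection of amplitudes\<close>

text \<open>The n-th derivative at 0 gives the moment equation with weights zeta_l^n. For n = 0, 1,
  2 these form a Vandermonde system with the three distinct cube roots of unity as nodes.\<close>

lemma plane_waves_independent:
  assumes "lam \<noteq> 0" and zero: "\<And>x. (\<Sum>l\<in>UNIV. c l * exp (\<i> * lam * zeta l * of_real x)) = 0"
  shows "c l = 0"
proof -
  have "(\<Sum>l\<in>UNIV. c l * (\<i> * lam * zeta l) ^ n * exp (\<i> * lam * zeta l * of_real x)) = 0" for n x
  proof (induction n arbitrary: x)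
    case 0
    then show ?case using zero by simp
  next
    case (Suc n)
    have "((\<lambda>x. \<Sum>l\<in>UNIV. c l * (\<i> * lam * zeta l) ^ n * exp (\<i> * lam * zeta l * of_real x))
        has_vector_derivative
          (\<Sum>l\<in>UNIV. c l * (\<i> * lam * zeta l) ^ Suc n * exp (\<i> * lam * zeta l * of_real x))) (at x)"
      by (rule has_vector_derivative_real_field)
        (auto intro!: derivative_eq_intros sum.cong simp: mult_ac)
    moreover have "((\<lambda>x. \<Sum>l\<in>UNIV. c l * (\<i> * lam * zeta l) ^ n * exp (\<i> * lam * zeta l * of_real x))
        has_vector_derivative 0) (at x)"
      unfolding Suc by simp
    ultimately show ?case
      by (rule vector_derivative_unique_at)
  qed
  from this[of _ 0] have "(\<i> * lam) ^ n * (\<Sum>l\<in>UNIV. c l * zeta l ^ n) = 0" for n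
    by (simp add: sum_distrib_left power_mult_distrib mult_ac)
  with \<open>lam \<noteq> 0\<close> have *: "(\<Sum>l\<in>UNIV. c l * zeta l ^ n) = 0" for n
    by simp
  define w where "w = zeta 1"
  have w: "1 + w + w ^ 2 = 0" "w ^ 3 = 1"
    using zeta_sum zeta_cube[of 1] by (simp_all add: w_def zeta_2)
  have "c 0 + c 1 + c 2 = 0" "c 0 + c 1 * w + c 2 * w^2 = 0" "c 0 + c 1 * w^2 + c 2 * w^4 = 0"
    using *[of 0] *[of 1] *[of 2] by (simp_all add: sum_012 zeta_2 w_def flip: power_mult)
  with w have "c 0 = 0 \<and> c 1 = 0 \<and> c 2 = 0"
    by (intro conjI; algebra)
  then show ?thesis
    using exhaust_012[of l] by auto
qed

text \<open>If \<open>y\<close> vanishes, so do the densities; the amplitudes are then constant, and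
  the expansion is a vanishing combination of plane waves.\<close>

lemma amplitudes_zero:
  assumes "lam \<noteq> 0" "amplitudes q lam c0 c (\<lambda>x. 0)"
  shows "c0 l = 0"
proof -
  have c: "c l x = c0 l" for l x
    using assms(2) by (auto simp: amplitudes_def primitive_from_def set_lebesgue_integral_def)
  show ?thesis
    using assms(2) by (intro plane_waves_independent[OF assms(1), of c0]) (simp add: amplitudes_def c)
qed

text \<open>The limit at minus infinity of the reflected function is the limit of \<open>F\<close>
  at plus infinity, which is \<open>c\<close> plus the total integral.\<close>

lemma primitive_from_reflect:
  assumes "primitive_from c F f"
  shows "primitive_from (c + (\<integral>t. f t \<partial>lborel)) (\<lambda>x. F (- x)) (\<lambda>x. - f (- x))"
  unfolding primitive_from_def
proof (intro conjI allI)
  have f: "integrable lborel f"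
    using assms by (simp add: primitive_from_def)
  then have f': "integrable lborel (\<lambda>x. f (- x))"
    using lborel_integrable_real_affine[of f "-1" 0] by simp
  then show "integrable lborel (\<lambda>x. - f (- x))"
    by simp
  fix x
  have "(LINT t:{..-x}|lborel. f t) = (\<integral>t. indicator {..-x} (- t) *\<^sub>R f (- t) \<partial>lborel)"
    using lborel_integral_real_affine[of "-1" "\<lambda>t. indicator {..-x} t *\<^sub>R f t" 0]
    by (simp add: set_lebesgue_integral_def)
  also have "\<dots> = (\<integral>t. f (- t) - indicator {..x} t *\<^sub>R f (- t) \<partial>lborel)"
  proof (rule integral_cong_AE)
    show "AE t in lborel. indicator {..-x} (- t) *\<^sub>R f (- t) = f (- t) - indicator {..x} t *\<^sub>R f (- t)"
      using AE_lborel_singleton[of x] by eventually_elim (auto simp: indicator_def)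
  qed (use f' in \<open>auto dest: borel_measurable_integrable\<close>)
  also have "\<dots> = (\<integral>t. f (- t) \<partial>lborel) - (LINT t:{..x}|lborel. f (- t))"
    using f' by (simp add: set_lebesgue_integral_def integrable_mult_indicator)
  also have "(\<integral>t. f (- t) \<partial>lborel) = (\<integral>t. f t \<partial>lborel)"
    using lborel_integral_real_affine[of "-1" f 0] by simp
  finally show "F (- x) = c + (\<integral>t. f t \<partial>lborel) + (LINT t:{..x}|lborel. - f (- t))"
    using assms by (simp add: primitive_from_def set_lebesgue_integral_def)
qed

text \<open>The sign from reversing the direction of integration cancels the one in -q(-x). The new
  limits \<open>d0\<close> stay unspecified: they are amplitudes at the opposite end, and the result
  is used only to conclude that a form is constant.\<close>

lemma amplitudes_reflect:
  assumes "amplitudes (\<lambda>x. - q (- x)) (- lam) c0 c y"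
  obtains d0 where "amplitudes q lam d0 (\<lambda>l x. c l (- x)) (\<lambda>x. y (- x))"
proof -
  have "\<exists>d. primitive_from d (\<lambda>x. c l (- x)) (\<lambda>t. \<i> * zeta l / (3 * (\<i> * lam)^2)
      * exp (- (\<i> * lam * zeta l * of_real t)) * of_real (q t) * y (- t))" for l
  proof -
    have "primitive_from (c0 l) (c l) (\<lambda>t. \<i> * zeta l / (3 * (\<i> * (- lam))^2)
      * exp (- (\<i> * (- lam) * zeta l * of_real t)) * of_real (- q (- t)) * y t)"
      by (rule amplitudes_primitive[OF assms])
    from primitive_from_reflect[OF this] show ?thesis
      by (auto simp: power2_eq_square)
  qed
  then obtain d0 where "\<forall>l. primitive_from (d0 l) (\<lambda>x. c l (- x)) (\<lambda>t. \<i> * zeta l / (3 * (\<i> * lam)^2)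
      * exp (- (\<i> * lam * zeta l * of_real t)) * of_real (q t) * y (- t))"
    by metis
  moreover have "y (- t) = (\<Sum>l\<in>UNIV. c l (- t) * exp (\<i> * lam * zeta l * of_real t))" for t
    using assms by (simp add: amplitudes_def)
  ultimately show thesis
    by (intro that[of d0]) (simp add: amplitudes_def)
qed

subsection \<open>Reflection and the transition matrix\<close>

lemma K1_reflect: "K1 (- lam) (- x) (- t) = K1 lam x t"
proof -
  have "\<i> * (- lam) * of_real (- x - - t) = \<i> * lam * of_real (x - t)"
    by (simp add: algebra_simps)
  then show ?thesis
    by (simp add: K1_def power2_commute)
qed

lemma set_integral_lborel_reflect:
  fixes f :: "real \<Rightarrow> 'a::{banach, second_countable_topology}"
  shows "(LINT t:A|lborel. f t) = (LINT t:uminus -` A|lborel. f (- t))"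
  using lborel_integral_real_affine[of "-1" "\<lambda>t. indicator A t *\<^sub>R f t" 0]
  by (simp add: set_lebesgue_integral_def indicator_def)

lemma borel_potential_cnj: "borel_potential q lam \<Longrightarrow> borel_potential q (cnj lam)"
  by (simp add: borel_potential_def)

lemma borel_potential_reflect:
  assumes "borel_potential q lam"
  shows "borel_potential (\<lambda>x. - q (- x)) (- lam)"
proof
  interpret borel_potential q lam by fact
  show "(\<lambda>x. - q (- x)) \<in> borel_measurable borel"
    by measurable
  show "- lam \<noteq> 0"
    using lam_nonzero by simp
  show "integrable lborel (\<lambda>t. \<bar>- q (- t)\<bar> * exp (2 * norm (- lam) * \<bar>t\<bar>))"
    using lborel_integrable_real_affine[OF q_weighted, of "-1" 0] by simp
qed

text \<open>\<open>K1\<close> is invariant under changing the sign of the parameter and of both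
  variables. The kernel of index n contains n factors of the potential, each contributing one
  sign.\<close>

lemma Kplus_reflect:
  assumes "borel_potential q lam"
  shows "Kplus q lam n x t = (-1) ^ n * Kminus (\<lambda>x. - q (- x)) (- lam) n (- x) (- t)"
proof (induction n arbitrary: t)
  case 0
  then show ?case by (simp add: K1_reflect)
next
  case (Suc n)
  interpret q: borel_potential q lam by fact
  interpret r: borel_potential "\<lambda>x. - q (- x)" "- lam"
    by (rule borel_potential_reflect[OF assms])
  have [measurable]: "Kminus (\<lambda>x. - q (- x)) (- lam) n (- x) \<in> borel_measurable borel"
    by (rule r.Kminus_measurable)
  have "Kplus q lam (Suc n) x t
      = (LINT s:{x..t}|lebesgue. (-1) ^ n * Kminus (\<lambda>x. - q (- x)) (- lam) n (- x) (- s)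
          * of_real (q s) * K1 lam s t)"
    by (simp add: Suc)
  also have "\<dots> = (LINT s:{x..t}|lborel. (-1) ^ n * Kminus (\<lambda>x. - q (- x)) (- lam) n (- x) (- s)
          * of_real (q s) * K1 lam s t)"
    by (rule set_integral_lebesgue_eq_lborel) simp_all
  also have "\<dots> = (LINT s:{x..t}|lborel. (-1) ^ Suc n * (Kminus (\<lambda>x. - q (- x)) (- lam) n (- x) (- s)
          * of_real (- q (- (- s))) * K1 (- lam) (- s) (- t)))"
    by (simp add: K1_reflect mult_ac)
  also have "\<dots> = (-1) ^ Suc n * (LINT s:{x..t}|lborel. Kminus (\<lambda>x. - q (- x)) (- lam) n (- x) (- s)
          * of_real (- q (- (- s))) * K1 (- lam) (- s) (- t))"
    by (rule set_integral_mult_right)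
  also have "{x..t} = uminus -` {-t..-x}"
    by auto
  also have "(LINT s:uminus -` {-t..-x}|lborel. Kminus (\<lambda>x. - q (- x)) (- lam) n (- x) (- s)
          * of_real (- q (- (- s))) * K1 (- lam) (- s) (- t))
      = (LINT s:{-t..-x}|lborel. Kminus (\<lambda>x. - q (- x)) (- lam) n (- x) s
          * of_real (- q (- s)) * K1 (- lam) s (- t))"
    by (rule set_integral_lborel_reflect [symmetric])
  also have "\<dots> = Kminus (\<lambda>x. - q (- x)) (- lam) (Suc n) (- x) (- t)"
    unfolding Kminus.simps by (rule set_integral_lebesgue_eq_lborel [symmetric]) simp_all
  finally show ?case .
qed

lemma Kplus_measurable:
  assumes "borel_potential q lam"
  shows "Kplus q lam n x \<in> borel_measurable borel"
proof -
  interpret r: borel_potential "\<lambda>x. - q (- x)" "- lam"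
    by (rule borel_potential_reflect[OF assms])
  have "Kplus q lam n x = (\<lambda>t. (-1) ^ n * Kminus (\<lambda>x. - q (- x)) (- lam) n (- x) (- t))"
    using Kplus_reflect[OF assms] by blast
  then show ?thesis
    by simp
qed

text \<open>The sign comes from (-\<i>)^(n+1) (-1)^n = -\<i>^(n+1); it is compensated later by the
  change from q to -q in the Jost integral. The order of the arguments secures convergence of the
  series.\<close>

lemma Nplus_reflect:
  assumes "borel_potential q lam" "x \<le> t"
  shows "Nplus q lam x t = - Nminus (\<lambda>x. - q (- x)) (- lam) (- x) (- t)"
proof -
  interpret r: borel_potential "\<lambda>x. - q (- x)" "- lam"
    by (rule borel_potential_reflect[OF assms(1)])
  have "(- \<i>) ^ Suc n * Kplus q lam n x t
      = - (\<i> ^ Suc n * Kminus (\<lambda>x. - q (- x)) (- lam) n (- x) (- t))" for n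
  proof -
    have "(- \<i>) ^ Suc n * (-1) ^ n = - (\<i> ^ Suc n * ((-1) ^ n * (-1) ^ n))"
      by (subst power_minus) simp
    also have "(-1) ^ n * (-1) ^ n = (1 :: complex)"
      by (simp flip: power_mult_distrib)
    finally show ?thesis
      by (simp add: Kplus_reflect[OF assms(1)] mult.assoc [symmetric] del: power_Suc)
  qed
  then show ?thesis
    using r.Nminus_summable[of "- t" "- x"] assms(2)
    by (simp add: Nplus_def Nminus_def suminf_minus del: power_Suc)
qed

lemma jost_v_reflect:
  assumes "borel_potential q lam"
  shows "jost_v q k lam x = jost_u (\<lambda>x. - q (- x)) k (- lam) (- x)"
proof -
  interpret q: borel_potential q lam by fact
  interpret r: borel_potential "\<lambda>x. - q (- x)" "- lam"
    by (rule borel_potential_reflect[OF assms])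
  define F where "F = (\<lambda>t. Nminus (\<lambda>x. - q (- x)) (- lam) (- x) t * of_real (- q (- t))
    * exp (\<i> * (- lam) * zeta k * of_real t))"
  have [measurable]: "F \<in> borel_measurable borel"
    unfolding F_def Nminus_def by measurable
  have "(LINT t:{x..}|lebesgue. Nplus q lam x t * of_real (q t) * exp (\<i> * lam * zeta k * of_real t))
      = (LINT t:{x..}|lebesgue. F (- t))"
    using Nplus_reflect[OF assms]
    by (intro set_lebesgue_integral_cong) (auto simp: F_def)
  also have "\<dots> = (LINT t:{x..}|lborel. F (- t))"
    by (rule set_integral_lebesgue_eq_lborel) simp_all
  also have "\<dots> = (LINT t:uminus -` {..-x}|lborel. F (- t))"
    by (rule arg_cong[where f = "\<lambda>A. LINT t:A|lborel. F (- t)"]) auto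
  also have "\<dots> = (LINT t:{..-x}|lborel. F t)"
    by (rule set_integral_lborel_reflect [symmetric])
  also have "\<dots> = (LINT t:{..-x}|lebesgue. F t)"
    by (rule set_integral_lebesgue_eq_lborel [symmetric]) simp_all
  finally show ?thesis
    by (simp add: jost_v_def jost_u_def F_def)
qed

section \<open>Amplitude matrices, the form J and the transition matrix\<close>

definition coef_matrix_u :: "(real \<Rightarrow> real) \<Rightarrow> complex \<Rightarrow> real \<Rightarrow> complex^3^3" where
  "coef_matrix_u q lam x = (\<chi> k l. coef_u q lam k l x)"

text \<open>
  Written through the reflected potential, so that its determinant and form follow from those of
  \<open>coef_matrix_u\<close>; its rows are the amplitudes of \<open>jost_v\<close> by \<open>jost_v_expand\<close>.
\<close>

definition coef_matrix_v :: "(real \<Rightarrow> real) \<Rightarrow> complex \<Rightarrow> real \<Rightarrow> complex^3^3" where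
  "coef_matrix_v q lam x = coef_matrix_u (\<lambda>x. - q (- x)) (- lam) (- x)"

lemma uminus_3: "- 1 = (2::3)" "- 2 = (1::3)"
  by simp_all

lemma zeta_squares: "zeta 1 ^ 2 = zeta 2" "zeta 2 ^ 2 = zeta 1"
proof -
  have "zeta 2 ^ 2 = zeta 1 ^ 3 * zeta 1"
    unfolding zeta_2 by (simp only: power_mult [symmetric] power_Suc2 [symmetric]) simp
  then show "zeta 2 ^ 2 = zeta 1"
    by (simp add: zeta_cube)
qed (simp add: zeta_2)

text \<open>Row k of \<open>J_mat\<close> has its single nonzero entry zeta_k^2 in column -k, so the
  matrix product is exactly the form conserved by \<open>amplitudes_form\<close>.\<close>

lemma J_form_entry:
  "(A ** J_mat ** conj_transpose B) $ j $ l = (\<Sum>k\<in>UNIV. zeta k ^ 2 * (A $ j $ k * cnj (B $ l $ (- k))))"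
  by (simp add: matrix_matrix_mult_def J_mat_def conj_transpose_def sum_012 uminus_3 zeta_squares mult_ac)

text \<open>This is the form of two identity matrices, that is, of the limiting amplitudes of
  \<open>jost_u\<close> at minus infinity.\<close>

lemma J_mat_entry:
  "J_mat $ j $ l = (\<Sum>k\<in>UNIV. zeta k ^ 2 * ((if j = k then 1 else 0) * cnj (if l = - k then 1 else 0)))"
proof -
  have "conj_transpose (mat 1) = (mat 1 :: complex^3^3)"
    by (simp add: conj_transpose_def mat_def vec_eq_iff)
  from J_form_entry[of "mat 1" "mat 1" j l, unfolded this matrix_mul_lid matrix_mul_rid]
  show ?thesis
    by (simp only: mat_def vec_lambda_beta)
qed

lemma J_mat_square: "J_mat ** J_mat = mat 1"
proof -
  have "zeta 1 * zeta 2 = 1"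
    using zeta_cube[of 1] by (simp add: zeta_2 power2_eq_square power3_eq_cube mult.assoc)
  then show ?thesis
    by (simp add: matrix_matrix_mult_def J_mat_def mat_def sum_012 vec_eq_iff all_012 mult.commute)
qed

lemma conj_transpose_mult: "conj_transpose (A ** B) = conj_transpose B ** conj_transpose A"
  by (simp add: conj_transpose_def matrix_matrix_mult_def vec_eq_iff mult.commute)

lemma coef_matrix_u_det:
  assumes "borel_potential q lam"
  shows "det (coef_matrix_u q lam x) = 1"
proof -
  interpret borel_potential q lam by fact
  have "det (coef_matrix_u q lam x) = det (\<chi> j l. if j = (l::3) then 1 else 0)"
    unfolding coef_matrix_u_def 
    by (rule amplitudes_det[of q lam "\<lambda>j l. if j = l then 1 else 0" "coef_u q lam"
          "\<lambda>k. jost_u q k lam", OF jost_u_amplitudes])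
  also have "\<dots> = 1"
    using det_I[where 'a = complex and 'n = 3] by (simp only: mat_def)
  finally show ?thesis .
qed

lemma coef_matrix_u_form:
  assumes "borel_potential q lam"
  shows "coef_matrix_u q lam x ** J_mat ** conj_transpose (coef_matrix_u q (cnj lam) x) = J_mat"
proof -
  interpret borel_potential q lam by fact
  interpret c: borel_potential q "cnj lam" by (rule borel_potential_cnj[OF assms])
  show ?thesis
    unfolding vec_eq_iff
    using amplitudes_form[OF jost_u_amplitudes c.jost_u_amplitudes]
    by (simp add: J_form_entry J_mat_entry coef_matrix_u_def)
qed

lemma coef_matrix_v_form:
  assumes "borel_potential q lam"
  shows "coef_matrix_v q lam x ** J_mat ** conj_transpose (coef_matrix_v q (cnj lam) x) = J_mat"
  using coef_matrix_u_form[OF borel_potential_reflect[OF assms], of "- x"]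
  by (simp add: coef_matrix_v_def)

lemma coef_matrix_v_det:
  assumes "borel_potential q lam"
  shows "det (coef_matrix_v q lam x) = 1"
  unfolding coef_matrix_v_def by (rule coef_matrix_u_det[OF borel_potential_reflect[OF assms]])

text \<open>The amplitudes of the two families are normalised at opposite ends, so neither end gives
  a value; constancy in x is all that holds, and it is what makes the transition matrix well
  defined.\<close>

lemma coef_matrix_mixed_form:
  assumes "borel_potential q lam"
  shows "coef_matrix_u q lam x ** J_mat ** conj_transpose (coef_matrix_v q (cnj lam) x)
    = coef_matrix_u q lam y ** J_mat ** conj_transpose (coef_matrix_v q (cnj lam) y)"
proof -
  interpret borel_potential q lam by fact
  interpret r: borel_potential "\<lambda>x. - q (- x)" "- cnj lam"
    by (intro borel_potential_reflect borel_potential_cnj assms)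
  have "(\<Sum>k\<in>UNIV. zeta k ^ 2 * (coef_u q lam j k x * cnj (coef_u (\<lambda>x. - q (- x)) (- cnj lam) l (- k) (- x))))
    = (\<Sum>k\<in>UNIV. zeta k ^ 2 * (coef_u q lam j k y * cnj (coef_u (\<lambda>x. - q (- x)) (- cnj lam) l (- k) (- y))))"
    for j l
  proof -
    obtain d0 where "amplitudes q (cnj lam) d0 (\<lambda>m x. coef_u (\<lambda>x. - q (- x)) (- cnj lam) l m (- x))
        (\<lambda>x. jost_u (\<lambda>x. - q (- x)) l (- cnj lam) (- x))"
      using amplitudes_reflect[OF r.jost_u_amplitudes] .
    from amplitudes_form[OF jost_u_amplitudes this] show ?thesis
      by simp
  qed
  then show ?thesis
    by (simp add: vec_eq_iff J_form_entry coef_matrix_u_def coef_matrix_v_def)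
qed

lemma jost_v_expand:
  assumes "borel_potential q lam"
  shows "jost_v q k lam x = (\<Sum>l\<in>UNIV. coef_matrix_v q lam x $ k $ l * exp (\<i> * lam * zeta l * of_real x))"
proof -
  interpret r: borel_potential "\<lambda>x. - q (- x)" "- lam"
    by (rule borel_potential_reflect[OF assms])
  show ?thesis
    unfolding jost_v_reflect[OF assms] amplitudes_expand[OF r.jost_u_amplitudes]
    by (simp add: coef_matrix_v_def coef_matrix_u_def)
qed

text \<open>After reflection the limiting amplitudes of the three solutions are the unit vectors, so
  those of the combination are the coefficients \<open>b\<close>; \<open>amplitudes_zero\<close>
  makes them vanish.\<close>

lemma jost_v_independent:
  assumes "borel_potential q lam" and zero: "\<And>x. (\<Sum>l\<in>UNIV. b l * jost_v q l lam x) = 0"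
  shows "b l = 0"
proof -
  interpret r: borel_potential "\<lambda>x. - q (- x)" "- lam"
    by (rule borel_potential_reflect[OF assms(1)])
  have "(\<Sum>l\<in>UNIV. b l * jost_u (\<lambda>x. - q (- x)) l (- lam) x) = 0" for x
    using zero[of "- x"] by (simp add: jost_v_reflect[OF assms(1)])
  with amplitudes_sum[of "\<lambda>x. - q (- x)" "- lam" "\<lambda>j l. if j = l then 1 else 0" _
      "\<lambda>k. jost_u (\<lambda>x. - q (- x)) k (- lam)", OF r.jost_u_amplitudes, where I = UNIV and a = b]
  have "amplitudes (\<lambda>x. - q (- x)) (- lam) (\<lambda>l. \<Sum>j\<in>UNIV. b j * (if j = l then 1 else 0))
      (\<lambda>l x. \<Sum>j\<in>UNIV. b j * coef_u (\<lambda>x. - q (- x)) (- lam) j l x) (\<lambda>x. 0)"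
    by (simp only:)
  from amplitudes_zero[OF r.lam_nonzero this]
  have "(\<Sum>j\<in>UNIV. b j * (if j = l then 1 else 0)) = 0" .
  then show ?thesis
    using exhaust_012[of l] by (auto simp: sum_012)
qed

lemma transition_matrix_coef:
  assumes "borel_potential q lam"
  shows "coef_matrix_u q lam x = transition_matrix q lam ** coef_matrix_v q lam x"
proof -
  interpret borel_potential q lam by fact
  \<comment> \<open>By the form identity and \<open>J_mat_square\<close>, the factor after
    \<open>coef_matrix_u\<close> is the inverse of \<open>coef_matrix_v\<close>, so \<open>T\<close>
    is the quotient of amplitude matrices. The point 0 is arbitrary, by
    \<open>coef_matrix_mixed_form\<close>.\<close>
  define T where "T = coef_matrix_u q lam 0 ** J_mat ** conj_transpose (coef_matrix_v q (cnj lam) 0) ** J_mat"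
  have T: "coef_matrix_u q lam x = T ** coef_matrix_v q lam x" for x
  proof -
    have "coef_matrix_v q lam x ** (J_mat ** conj_transpose (coef_matrix_v q (cnj lam) x) ** J_mat) = mat 1"
      using coef_matrix_v_form[OF assms, of x] J_mat_square by (simp add: matrix_mul_assoc)
    then have inv: "J_mat ** conj_transpose (coef_matrix_v q (cnj lam) x) ** J_mat ** coef_matrix_v q lam x = mat 1"
      by (simp add: matrix_left_right_inverse)
    have "T = coef_matrix_u q lam x ** J_mat ** conj_transpose (coef_matrix_v q (cnj lam) x) ** J_mat"
      unfolding T_def coef_matrix_mixed_form[OF assms, of 0 x] ..
    then have "T ** coef_matrix_v q lam x = coef_matrix_u q lam x **
        (J_mat ** conj_transpose (coef_matrix_v q (cnj lam) x) ** J_mat ** coef_matrix_v q lam x)"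
      by (simp add: matrix_mul_assoc)
    then show ?thesis
      by (simp add: inv)
  qed
  have "transition_matrix q lam = T"
    unfolding transition_matrix_def
  proof (rule the_equality)
    have "jost_u q k lam x = (\<Sum>l\<in>UNIV. T $ k $ l * jost_v q l lam x)" for k x
    proof -
      have "jost_u q k lam x = (\<Sum>m\<in>UNIV. (T ** coef_matrix_v q lam x) $ k $ m * exp (\<i> * lam * zeta m * of_real x))"
        unfolding T [symmetric] by (subst amplitudes_expand[OF jost_u_amplitudes]) (simp add: coef_matrix_u_def)
      also have "\<dots> = (\<Sum>m\<in>UNIV. \<Sum>l\<in>UNIV. T $ k $ l * (coef_matrix_v q lam x $ l $ m * exp (\<i> * lam * zeta m * of_real x)))"
        by (simp add: matrix_matrix_mult_def sum_distrib_right mult.assoc)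
      also have "\<dots> = (\<Sum>l\<in>UNIV. \<Sum>m\<in>UNIV. T $ k $ l * (coef_matrix_v q lam x $ l $ m * exp (\<i> * lam * zeta m * of_real x)))"
        by (rule sum.swap)
      finally show ?thesis
        by (simp add: jost_v_expand[OF assms] sum_distrib_left)
    qed
    then show *: "\<forall>k x. jost_u q k lam x = (\<Sum>l\<in>UNIV. T $ k $ l * jost_v q l lam x)"
      by blast
    fix T' assume T': "\<forall>k x. jost_u q k lam x = (\<Sum>l\<in>UNIV. T' $ k $ l * jost_v q l lam x)"
    have "T' $ k $ l - T $ k $ l = 0" for k l
    proof (rule jost_v_independent[OF assms])
      fix x
      have "(\<Sum>l\<in>UNIV. T' $ k $ l * jost_v q l lam x) = (\<Sum>l\<in>UNIV. T $ k $ l * jost_v q l lam x)"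
        using * T' by metis
      then show "(\<Sum>l\<in>UNIV. (T' $ k $ l - T $ k $ l) * jost_v q l lam x) = 0"
        by (simp add: left_diff_distrib sum_subtractf)
    qed
    then show "T' = T"
      by (simp add: vec_eq_iff)
  qed
  then show ?thesis
    using T by simp
qed

lemma transition_matrix_det:
  assumes "borel_potential q lam"
  shows "det (transition_matrix q lam) = 1"
  using arg_cong[OF transition_matrix_coef[OF assms, of 0], of det]
  by (simp add: det_mul coef_matrix_u_det[OF assms] coef_matrix_v_det[OF assms])

lemma transition_matrix_form:
  assumes "borel_potential q lam"
  shows "transition_matrix q lam ** J_mat ** conj_transpose (transition_matrix q (cnj lam)) = J_mat"
proof -
  let ?T = "transition_matrix q lam" and ?T' = "transition_matrix q (cnj lam)"
  have "J_mat = (?T ** coef_matrix_v q lam 0) ** J_mat ** conj_transpose (?T' ** coef_matrix_v q (cnj lam) 0)"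
    using coef_matrix_u_form[OF assms, of 0]
    unfolding transition_matrix_coef[OF assms] transition_matrix_coef[OF borel_potential_cnj[OF assms]] ..
  also have "\<dots> = ?T ** (coef_matrix_v q lam 0 ** J_mat ** conj_transpose (coef_matrix_v q (cnj lam) 0))
      ** conj_transpose ?T'"
    by (simp add: conj_transpose_mult matrix_mul_assoc)
  finally show ?thesis
    by (simp add: coef_matrix_v_form[OF assms])
qed

section \<open>From the weighted square integrable class to an integrable Borel potential\<close>

lemma integrable_exp_minus_abs:
  assumes "0 < (c::real)"
  shows "integrable lborel (\<lambda>t. exp (- c * \<bar>t\<bar>))"
proof -
  have "(\<lambda>t. exp (- c * t)) absolutely_integrable_on {0..}"
    using integrable_on_exp_minus_to_infinity[OF assms, of 0]
    by (intro nonnegative_absolutely_integrable_1) auto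
  then have 1: "integrable lborel (\<lambda>t. indicator {0..} t *\<^sub>R exp (- c * t))"
    unfolding set_integrable_def by (subst (asm) integrable_completion) simp_all
  then have 2: "integrable lborel (\<lambda>t. indicator {0..} (- t) *\<^sub>R exp (- c * (- t)))"
    using lborel_integrable_real_affine[OF 1, of "-1" 0] by simp
  show ?thesis
    by (rule Bochner_Integration.integrable_bound[OF Bochner_Integration.integrable_add[OF 1 2]])
      (auto intro!: AE_I2 simp: indicator_def abs_if)
qed

text \<open>A pointwise form of Cauchy-Schwarz: split the function into |q| exp(a |x|) and exp(-(a -
  r) |x|), and bound their product by the sum of their squares. Both squares are integrable, the
  second because r < a.\<close>

lemma weighted_L2_imp_L1:
  fixes q :: "real \<Rightarrow> real"
  assumes [measurable]: "q \<in> borel_measurable borel" and "r < a"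
    and q2: "integrable lborel (\<lambda>x. \<bar>q x\<bar>^2 * exp (2 * a * \<bar>x\<bar>))"
  shows "integrable lborel (\<lambda>x. \<bar>q x\<bar> * exp (r * \<bar>x\<bar>))"
proof (rule Bochner_Integration.integrable_bound)
  show "integrable lborel (\<lambda>x. \<bar>q x\<bar>^2 * exp (2 * a * \<bar>x\<bar>) + exp (- (2 * (a - r)) * \<bar>x\<bar>))"
    using \<open>r < a\<close> by (intro Bochner_Integration.integrable_add q2 integrable_exp_minus_abs) simp
  show "AE x in lborel. norm (\<bar>q x\<bar> * exp (r * \<bar>x\<bar>))
      \<le> norm (\<bar>q x\<bar>^2 * exp (2 * a * \<bar>x\<bar>) + exp (- (2 * (a - r)) * \<bar>x\<bar>))"
  proof (rule AE_I2)
    fix x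
    define A where "A = \<bar>q x\<bar> * exp (a * \<bar>x\<bar>)"
    define B where "B = exp (- (a - r) * \<bar>x\<bar>)"
    have "\<bar>q x\<bar> * exp (r * \<bar>x\<bar>) = A * B"
      by (simp add: A_def B_def algebra_simps flip: exp_add)
    also have "\<dots> \<le> A^2 + B^2"
      using sum_squares_bound[of A B] zero_le_power2[of A] zero_le_power2[of B] by linarith
    also have "\<dots> = \<bar>q x\<bar>^2 * exp (2 * a * \<bar>x\<bar>) + exp (- (2 * (a - r)) * \<bar>x\<bar>)"
      by (simp add: A_def B_def power_mult_distrib algebra_simps flip: exp_double)
    finally show "norm (\<bar>q x\<bar> * exp (r * \<bar>x\<bar>))
      \<le> norm (\<bar>q x\<bar>^2 * exp (2 * a * \<bar>x\<bar>) + exp (- (2 * (a - r)) * \<bar>x\<bar>))"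
      by simp
  qed
qed measurable

lemma transition_matrix_cong_AE:
  assumes [measurable]: "q \<in> borel_measurable lebesgue" and r: "borel_potential r lam"
    and AE: "AE x in lebesgue. q x = r x"
  shows "transition_matrix q lam = transition_matrix r lam"
proof -
  interpret borel_potential r lam by fact
  have eq: "(LINT t:A|lebesgue. F t * of_real (q t) * H t) = (LINT t:A|lebesgue. F t * of_real (r t) * H t)"
    if "F \<in> borel_measurable borel" "H \<in> borel_measurable borel" "A \<in> sets borel"
    for A and F H :: "real \<Rightarrow> complex"
  proof (rule set_lebesgue_integral_cong_AE)
    have [measurable]: "F \<in> borel_measurable lebesgue" "H \<in> borel_measurable lebesgue" "r \<in> borel_measurable lebesgue"
      using that q_borel by (auto intro: measurable_completion)
    show "(\<lambda>t. F t * of_real (q t) * H t) \<in> borel_measurable lebesgue"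
      "(\<lambda>t. F t * of_real (r t) * H t) \<in> borel_measurable lebesgue"
      by measurable
    show "AE t\<in>A in lebesgue. F t * of_real (q t) * H t = F t * of_real (r t) * H t"
      using AE by eventually_elim simp
  qed (use that in simp)
  have [measurable]: "Kplus r lam n x \<in> borel_measurable borel" for n x
    by (rule Kplus_measurable[OF r])
  \<comment> \<open>The equality is exact, although the potentials agree only almost everywhere: the
    potential enters the kernels only under an integral.\<close>
  have Km: "Kminus q lam n = Kminus r lam n" for n
    by (induction n) (simp_all add: eq)
  have Kp: "Kplus q lam n = Kplus r lam n" for n
    by (induction n) (simp_all add: eq)
  have "Nminus q lam = Nminus r lam" "Nplus q lam = Nplus r lam"
    by (simp_all add: fun_eq_iff Nminus_def Nplus_def Km Kp)
  moreover have "Nminus r lam x \<in> borel_measurable borel" "Nplus r lam x \<in> borel_measurable borel" for x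
    unfolding Nminus_def Nplus_def by measurable
  ultimately have "jost_u q k lam x = jost_u r k lam x" "jost_v q k lam x = jost_v r k lam x" for k x
    by (simp_all add: jost_u_def jost_v_def eq)
  then show ?thesis
    by (simp add: transition_matrix_def)
qed

theorem lemma2p2:
  fixes a :: real and q :: "real \<Rightarrow> real"
  assumes a_pos: "a > 0"
    and q_measurable: "q \<in> borel_measurable lebesgue"
    and q_integrable: "integrable lebesgue (\<lambda>x. \<bar>q x\<bar>^2 * exp (2 * a * \<bar>x\<bar>))"
  shows "\<forall>lam::complex. 0 < norm lam \<and> norm lam < a / 3 \<longrightarrow>
      det (transition_matrix q lam) = 1
    \<and> J_mat = transition_matrix q lam ** J_mat ** conj_transpose (transition_matrix q (cnj lam))
    \<and> 1 = transition_coeff q 0 0 lam * cnj_fun (transition_coeff q 0 0) lam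
        + zeta 1 * transition_coeff q 0 2 lam * cnj_fun (transition_coeff q 0 1) lam
        + zeta 2 * transition_coeff q 0 1 lam * cnj_fun (transition_coeff q 0 2) lam"
proof (intro allI impI)
  fix lam :: complex
  assume lam: "0 < norm lam \<and> norm lam < a / 3"
  obtain r where [measurable]: "r \<in> borel_measurable borel" and AE: "AE x in lebesgue. q x = r x"
    using completion_ex_borel_measurable_real[OF q_measurable] by (auto simp: AE_completion)
  have "integrable lebesgue (\<lambda>x. \<bar>r x\<bar>^2 * exp (2 * a * \<bar>x\<bar>))"
  proof (rule integrable_cong_AE_imp[OF q_integrable])
    show "(\<lambda>x. \<bar>r x\<bar>^2 * exp (2 * a * \<bar>x\<bar>)) \<in> borel_measurable lebesgue"
      by (rule measurable_completion) simp
    show "AE x in lebesgue. \<bar>q x\<bar>^2 * exp (2 * a * \<bar>x\<bar>) = \<bar>r x\<bar>^2 * exp (2 * a * \<bar>x\<bar>)"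
      using AE by eventually_elim simp
  qed
  then have "integrable lborel (\<lambda>x. \<bar>r x\<bar>^2 * exp (2 * a * \<bar>x\<bar>))"
    by (subst (asm) integrable_completion) simp_all
  \<comment> \<open>The weight needed is r = 2 |lam|, and |lam| < a/3 gives 2 |lam| < 2a/3 <
    a.\<close>
  then have "integrable lborel (\<lambda>x. \<bar>r x\<bar> * exp (2 * norm lam * \<bar>x\<bar>))"
    using lam a_pos by (intro weighted_L2_imp_L1[where a = a]) simp_all
  then have r: "borel_potential r lam"
    using lam by (simp add: borel_potential_def)
  have T: "transition_matrix q lam = transition_matrix r lam"
    "transition_matrix q (cnj lam) = transition_matrix r (cnj lam)"
    by (intro transition_matrix_cong_AE q_measurable AE r borel_potential_cnj)+
  have form: "J_mat = transition_matrix q lam ** J_mat ** conj_transpose (transition_matrix q (cnj lam))"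
    unfolding T using transition_matrix_form[OF r] by simp
  \<comment> \<open>The scalar identity is the entry (0,0) of the matrix identity; the pairing of k
    with -k exchanges the indices 1 and 2 in the conjugated coefficient.\<close>
  have "1 = J_mat $ 0 $ 0"
    by (simp add: J_mat_def)
  also have "\<dots> = (\<Sum>k\<in>UNIV. zeta k ^ 2 * (transition_matrix q lam $ 0 $ k
      * cnj (transition_matrix q (cnj lam) $ 0 $ (- k))))"
    by (subst form) (rule J_form_entry)
  also have "\<dots> = transition_coeff q 0 0 lam * cnj_fun (transition_coeff q 0 0) lam
        + zeta 1 * transition_coeff q 0 2 lam * cnj_fun (transition_coeff q 0 1) lam
        + zeta 2 * transition_coeff q 0 1 lam * cnj_fun (transition_coeff q 0 2) lam"
    by (simp add: sum_012 uminus_3 zeta_squares transition_coeff_def cnj_fun_def mult.assoc)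
  finally show "det (transition_matrix q lam) = 1
    \<and> J_mat = transition_matrix q lam ** J_mat ** conj_transpose (transition_matrix q (cnj lam))
    \<and> 1 = transition_coeff q 0 0 lam * cnj_fun (transition_coeff q 0 0) lam
        + zeta 1 * transition_coeff q 0 2 lam * cnj_fun (transition_coeff q 0 1) lam
        + zeta 2 * transition_coeff q 0 1 lam * cnj_fun (transition_coeff q 0 2) lam"
    using form transition_matrix_det[OF r] unfolding T by blast
qed

end
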